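(* There exists a data structure in the word RAM model with word size $\Theta(\log n)$ that, for any $n$-vertex interval graph given in universal interval representation, uses $\log_2(n!)+O(n^{2/3}\log n)$ bits of space and answers degree queries $\deg(v)$ in $O(1)$ time.
   Context: An interval graph has an interval $I_v$ of the real line for each vertex $v$, with $u,v$ adjacent iff $I_u\cap I_v\neq\emptyset$. A universal interval representation of an $n$-vertex interval graph is an interval representation in which every $i\in[n]$ is the left endpoint of exactly one interval; vertex $i$ is identified with the interval $I_i=[i,e_i]$ with integer $e_i\in[i,n]$. Queries refer to vertices by these labels. $\deg(v)$ returns the number of neighbours of $v$. The data structure need not retain access to the input after preprocessing. *)

theory Defs
  imports Complex_Main "HOL-Library.Landau_Symbols"
begin

subsection \<open>Interval graphs\<close>

definition interval_graph :: "'a set \<Rightarrow> ('a \<Rightarrow> real set) \<Rightarrow> 'a set set" where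
  "interval_graph V I = {{u, v} |u v. u \<in> V \<and> v \<in> V \<and> u \<noteq> v \<and> I u \<inter> I v \<noteq> {}}"

definition degree :: "'a set set \<Rightarrow> 'a \<Rightarrow> nat" where
  "degree E v = card {u. {u, v} \<in> E}"

text \<open>
  In a universal representation every \<open>i \<in> {1..n}\<close> is the left endpoint of exactly one interval,
  and the vertex owning that interval is named \<open>i\<close>.  The representation is therefore given by
  the map \<open>e\<close> of right endpoints; values of \<open>e\<close> outside \<open>{1..n}\<close> are irrelevant.
\<close>

definition universal_rep :: "nat \<Rightarrow> (nat \<Rightarrow> nat) \<Rightarrow> bool" where
  "universal_rep n e \<longleftrightarrow> (\<forall>i\<in>{1..n}. e i \<in> {i..n})"

definition rep_interval :: "(nat \<Rightarrow> nat) \<Rightarrow> nat \<Rightarrow> real set" where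
  "rep_interval e i = {real i..real (e i)}"


subsection \<open>The word RAM\<close>

text \<open>
  The word size is a run-time parameter \<open>w\<close> and a word is a natural number below \<open>2 ^ w\<close>.
  A program is a finite list of instructions that does not depend on \<open>w\<close> and can mention only
  finitely many registers.  Every instruction costs one time unit.
\<close>

datatype binop = Add | Sub | Mul | Div | Mod | And | Or | Xor | Shl | Shr

datatype instr =
    Const nat nat              \<comment> \<open>\<open>Const r c\<close>: \<open>r := c\<close>, truncated to a word\<close>
  | Op binop nat nat nat       \<comment> \<open>\<open>Op f r a b\<close>: \<open>r := f a b\<close>\<close>
  | Load nat nat               \<comment> \<open>\<open>Load r a\<close>: \<open>r := memory[a]\<close>\<close>
  | Store nat nat              \<comment> \<open>\<open>Store a r\<close>: \<open>memory[a] := r\<close>\<close>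
  | Jump_less nat nat nat      \<comment> \<open>\<open>Jump_less a b l\<close>: go to \<open>l\<close> if \<open>a < b\<close>\<close>
  | Jump_eq nat nat nat        \<comment> \<open>\<open>Jump_eq a b l\<close>: go to \<open>l\<close> if \<open>a = b\<close>\<close>

type_synonym program = "instr list"

record state =
  pc :: nat
  regs :: "nat \<Rightarrow> nat"
  mem :: "nat \<Rightarrow> nat"

context includes bit_operations_syntax
begin

text \<open>
  \<open>Sub\<close> wraps around: on words \<open>a\<close> and \<open>b\<close> the natural number \<open>2 ^ w + a - b\<close> is
  not truncated at zero.  Division by zero gives \<open>0\<close>, and \<open>a mod 0 = a\<close>.
\<close>

fun binop_val :: "nat \<Rightarrow> binop \<Rightarrow> nat \<Rightarrow> nat \<Rightarrow> nat" where
  "binop_val w Add a b = (a + b) mod 2 ^ w"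
| "binop_val w Sub a b = (2 ^ w + a - b) mod 2 ^ w"
| "binop_val w Mul a b = (a * b) mod 2 ^ w"
| "binop_val w Div a b = a div b"
| "binop_val w Mod a b = a mod b"
| "binop_val w And a b = a AND b"
| "binop_val w Or  a b = a OR b"
| "binop_val w Xor a b = a XOR b"
| "binop_val w Shl a b = (a * 2 ^ b) mod 2 ^ w"
| "binop_val w Shr a b = a div 2 ^ b"

end

fun exec :: "nat \<Rightarrow> instr \<Rightarrow> state \<Rightarrow> state" where
  "exec w (Const r c) s =
     s\<lparr>pc := Suc (pc s), regs := (regs s)(r := c mod 2 ^ w)\<rparr>"
| "exec w (Op f r a b) s =
     s\<lparr>pc := Suc (pc s), regs := (regs s)(r := binop_val w f (regs s a) (regs s b))\<rparr>"
| "exec w (Load r a) s =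
     s\<lparr>pc := Suc (pc s), regs := (regs s)(r := mem s (regs s a))\<rparr>"
| "exec w (Store a r) s =
     s\<lparr>pc := Suc (pc s), mem := (mem s)(regs s a := regs s r)\<rparr>"
| "exec w (Jump_less a b l) s =
     s\<lparr>pc := (if regs s a < regs s b then l else Suc (pc s))\<rparr>"
| "exec w (Jump_eq a b l) s =
     s\<lparr>pc := (if regs s a = regs s b then l else Suc (pc s))\<rparr>"

text \<open>A machine halts by leaving its program.\<close>

definition halted :: "program \<Rightarrow> state \<Rightarrow> bool" where
  "halted P s \<longleftrightarrow> length P \<le> pc s"

definition step :: "nat \<Rightarrow> program \<Rightarrow> state \<Rightarrow> state" where
  "step w P s = (if halted P s then s else exec w (P ! pc s) s)"

text \<open>
  The memory initially holds the words of the data structure from address \<open>0\<close> on and zeros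
  afterwards; the argument of the query is in register \<open>0\<close>, all other registers are zero.
\<close>

definition init_state :: "nat list \<Rightarrow> nat \<Rightarrow> state" where
  "init_state D x =
     \<lparr>pc = 0,
      regs = (\<lambda>r. if r = 0 then x else 0),
      mem = (\<lambda>a. if a < length D then D ! a else 0)\<rparr>"

text \<open>
  On data structure \<open>D\<close> and argument \<open>x\<close>, program \<open>P\<close> halts after at most \<open>T\<close> steps with
  \<open>y\<close> in register \<open>0\<close>.  The memory has to be as it was before, so that any number of queries
  can be answered one after the other.
\<close>

definition answers_within :: "nat \<Rightarrow> program \<Rightarrow> nat list \<Rightarrow> nat \<Rightarrow> nat \<Rightarrow> nat \<Rightarrow> bool" where
  "answers_within w P D x T y \<longleftrightarrow>
     (\<exists>t\<le>T. let s = (step w P ^^ t) (init_state D x) in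
        halted P s \<and> regs s 0 = y \<and> mem s = mem (init_state D x))"

definition space_bits :: "nat \<Rightarrow> nat list \<Rightarrow> nat" where
  "space_bits w D = w * length D"

end

theory Submission
  imports Defs "HOL-Real_Asymp.Real_Asymp"
begin

text \<open>
  If \<open>c\<close> counts the intervals ending before vertex \<open>v\<close>, then \<open>deg v = e v - c - 1\<close>, so only the
  degrees need to be stored.  Put \<open>q = \<lceil>n\<^sup>1\<^sup>/\<^sup>3\<rceil>\<close> and cut the vertices into
  blocks of length \<open>q\<close>.  Since \<open>c\<close> is monotone and at most \<open>q\<^sup>3\<close>, it grows by more than
  \<open>q\<^sup>2\<close> on fewer than \<open>q\<close> blocks, whose degrees can be stored verbatim.  On any other block
  the degrees lie in a window of length \<open>n - v + O(q\<^sup>2)\<close>, and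
  \<open>\<Sum>\<^sub>v log (n - v + O(q\<^sup>2)) = log n! + O(q\<^sup>2 log n)\<close>.

  Numbers from a window of size \<open>X\<close> are stored with a loss of \<open>O(1/q)\<close> bits each by a spill
  chain: \<open>x\<close> is split into \<open>x mod Y\<close> and \<open>x div Y\<close>; the remainder shares a field of \<open>k\<close> bits
  with the quotient spilled from the predecessor, the quotient is spilled to the next field.  If the
  spill has \<open>S\<close> values, \<open>Y = 2\<^sup>k div S\<close> makes the product \<open>Y * S\<close> almost fill the field.  So \<open>x\<close>
  is recovered from two adjacent fields.  The window size is kept constant on superblocks of
  \<open>q\<^sup>2\<close> vertices, so that \<open>q\<close> tables of \<open>O(q)\<close> words describe the formats of all chains.
\<close>

subsection \<open>Degrees and their windows\<close>

text \<open>The labels up to \<open>e (Suc u)\<close> are the vertex itself, its neighbours and the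
  intervals that end before it. Vertices are counted from 0: \<open>u\<close> stands for the label
  \<open>Suc u\<close>.\<close>

lemma degree_eq:
  assumes rep: "universal_rep n e" and u: "u < n"
  shows "degree (interval_graph {1..n} (rep_interval e)) (Suc u) + card {x \<in> {1..n}. e x \<le> u} + 1
    = e (Suc u)"
proof -
  define N where "N = {x. {x, Suc u} \<in> interval_graph {1..n} (rep_interval e)}"
  define F where "F = {x \<in> {1..n}. e x \<le> u}"
  have e: "x \<le> e x \<and> e x \<le> n" if "x \<in> {1..n}" for x
    using rep that unfolding universal_rep_def by auto
  have meet: "rep_interval e x \<inter> rep_interval e y \<noteq> {} \<longleftrightarrow> x \<le> e y \<and> y \<le> e x"
    if "x \<in> {1..n}" "y \<in> {1..n}" for x y
    using e[OF that(1)] e[OF that(2)] by (auto simp: rep_interval_def)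
  have N: "N = {x \<in> {1..n}. x \<noteq> Suc u \<and> x \<le> e (Suc u) \<and> Suc u \<le> e x}" (is "_ = ?R")
  proof (intro equalityI subsetI)
    fix x assume "x \<in> N"
    then obtain a b where ab: "{x, Suc u} = {a, b}" "a \<in> {1..n}" "b \<in> {1..n}" "a \<noteq> b"
      "rep_interval e a \<inter> rep_interval e b \<noteq> {}"
      unfolding N_def interval_graph_def by blast
    from ab(1,4) have "x = a \<and> Suc u = b \<or> x = b \<and> Suc u = a" by (auto simp: doubleton_eq_iff)
    then show "x \<in> ?R" using ab meet by auto
  next
    fix x assume x: "x \<in> ?R"
    then have "rep_interval e x \<inter> rep_interval e (Suc u) \<noteq> {}" using u by (subst meet) auto
    moreover have "x \<in> {1..n}" "Suc u \<in> {1..n}" "x \<noteq> Suc u" using x u by auto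
    ultimately show "x \<in> N" unfolding N_def interval_graph_def by blast
  qed
  have eq: "{1..e (Suc u)} = insert (Suc u) (N \<union> F)"
  proof (intro equalityI subsetI)
    fix x assume "x \<in> {1..e (Suc u)}"
    then show "x \<in> insert (Suc u) (N \<union> F)"
      using e[of "Suc u"] u unfolding N F_def by auto
  next
    fix x assume "x \<in> insert (Suc u) (N \<union> F)"
    then show "x \<in> {1..e (Suc u)}"
      using e[of "Suc u"] e[of x] u unfolding N F_def by auto
  qed
  have "finite (N \<union> F)" "N \<inter> F = {}" "Suc u \<notin> N \<union> F"
    using e[of "Suc u"] u unfolding N F_def by auto
  then have "card {1..e (Suc u)} = card N + card F + 1"
    unfolding eq by (simp add: card_Un_disjoint)
  then show ?thesis unfolding degree_def N_def F_def by simp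
qed

text \<open>The increments telescope to at most \<open>q * q ^ 2\<close>; by monotonicity the
  truncated differences are true ones.\<close>

lemma few_large_increments:
  fixes C :: "nat \<Rightarrow> nat"
  assumes "mono C" and C: "C (m * q) \<le> q ^ 3" and q: "q > 0"
  shows "card {b. b < m \<and> q\<^sup>2 < C (Suc b * q) - C (b * q)} \<le> q"
proof -
  let ?L = "{b. b < m \<and> q\<^sup>2 < C (Suc b * q) - C (b * q)}"
  have "card ?L * q\<^sup>2 = (\<Sum>b\<in>?L. q\<^sup>2)" by simp
  also have "\<dots> \<le> (\<Sum>b\<in>?L. C (Suc b * q) - C (b * q))" by (intro sum_mono) auto
  also have "\<dots> \<le> (\<Sum>b<m. C (Suc b * q) - C (b * q))" by (intro sum_mono2) auto
  also have "\<dots> = C (m * q) - C 0"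
  proof -
    have "(\<Sum>b<m. C (Suc b * q) - C (b * q)) + C 0 = C (m * q)" for m
    proof (induction m)
      case (Suc m)
      have "C (m * q) \<le> C (Suc m * q)" using \<open>mono C\<close> by (simp add: monoD)
      then show ?case using Suc by simp
    qed simp
    from this[of m] show ?thesis by simp
  qed
  also have "\<dots> \<le> q * q\<^sup>2" using C by (simp add: power3_eq_cube power2_eq_square)
  finally show ?thesis using q by simp
qed

text \<open>
  The window size in superblock \<open>j\<close>.  The maximum keeps it below \<open>n - q\<close>, so that every field
  of a spill chain fits into a word even if the word size is barely \<open>log n\<close>; the price is that the
  blocks of the first two superblocks may be exceptional.
\<close>

definition alphabet :: "nat \<Rightarrow> nat \<Rightarrow> nat \<Rightarrow> nat" where
  "alphabet n q j = (n - max j 2 * q\<^sup>2) + q\<^sup>2"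

text \<open>The bound on \<open>a\<close> lets the base of a block fit into a word; positions from
  \<open>n\<close> on, present because \<open>q ^ 3\<close> may exceed \<open>n\<close>, are
  unconstrained.\<close>

definition fits :: "nat \<Rightarrow> nat \<Rightarrow> (nat \<Rightarrow> nat) \<Rightarrow> nat \<Rightarrow> nat \<Rightarrow> bool" where
  "fits n q D b a \<longleftrightarrow> a \<le> n \<and>
    (\<forall>u. u div q = b \<and> u < n \<longrightarrow> a \<le> D u \<and> D u < a + alphabet n q (b div q))"

definition exceptional :: "nat \<Rightarrow> nat \<Rightarrow> (nat \<Rightarrow> nat) \<Rightarrow> nat \<Rightarrow> bool" where
  "exceptional n q D b \<longleftrightarrow> (\<forall>a. \<not> fits n q D b a)"

text \<open>On the block, \<open>C\<close> varies by at most \<open>q ^ 2\<close>, and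
  \<open>D u + C u\<close> is at least \<open>b * q\<close> and below \<open>n\<close>; so
  \<open>D\<close> has a window of length \<open>n - b * q + q ^ 2\<close>. From
  \<open>b = 2 * q\<close> on the maximum in \<open>alphabet\<close> has no effect.\<close>

lemma fits_of_small_increment:
  fixes C D :: "nat \<Rightarrow> nat"
  assumes C: "mono C" "C (Suc b * q) - C (b * q) \<le> q\<^sup>2"
    and D: "\<And>u. u < n \<Longrightarrow> u \<le> D u + C u \<and> D u + C u < n"
    and b: "2 * q \<le> b" "b * q \<le> n" and q: "q > 0"
  shows "fits n q D b (b * q - C (Suc b * q))"
  unfolding fits_def
proof (intro conjI allI impI)
  show "b * q - C (Suc b * q) \<le> n" using b by simp
  fix u assume u: "u div q = b \<and> u < n"
  have bu: "b * q \<le> u" "u < Suc b * q"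
    using u q dividend_less_div_times[of q u] by (auto simp: add.commute)
  have Cu: "C (b * q) \<le> C u" "C u \<le> C (Suc b * q)" using C(1) bu by (auto intro: monoD)
  show "b * q - C (Suc b * q) \<le> D u" using bu Cu D[of u] u by linarith
  have "b div q * q\<^sup>2 \<le> b * q"
    by (simp add: power2_eq_square flip: mult.assoc)
  moreover have "max (b div q) 2 = b div q"
    using div_le_mono[OF b(1), of q] q by simp
  ultimately have "n - b * q + q\<^sup>2 \<le> alphabet n q (b div q)"
    unfolding alphabet_def by simp
  then show "D u < b * q - C (Suc b * q) + alphabet n q (b div q)"
    using bu Cu D[of u] u C(2) by linarith
qed

text \<open>There are two sources: the first \<open>2 * q\<close> blocks, given up because of the
  maximum in \<open>alphabet\<close>, and at most \<open>q\<close> large increments.\<close>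

lemma card_exceptional:
  fixes C D :: "nat \<Rightarrow> nat"
  assumes C: "mono C" "C (q\<^sup>2 * q) \<le> q ^ 3"
    and D: "\<And>u. u < n \<Longrightarrow> u \<le> D u + C u \<and> D u + C u < n"
    and q: "q > 0"
  shows "card {b. b < q\<^sup>2 \<and> exceptional n q D b} \<le> 3 * q"
proof -
  let ?L = "{b. b < q\<^sup>2 \<and> q\<^sup>2 < C (Suc b * q) - C (b * q)}"
  have "{b. b < q\<^sup>2 \<and> exceptional n q D b} \<subseteq> {..<2 * q} \<union> ?L"
  proof
    fix b assume "b \<in> {b. b < q\<^sup>2 \<and> exceptional n q D b}"
    then have b: "b < q\<^sup>2" "\<And>a. \<not> fits n q D b a" by (auto simp: exceptional_def)
    show "b \<in> {..<2 * q} \<union> ?L"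
    proof (rule ccontr)
      assume nb: "b \<notin> {..<2 * q} \<union> ?L"
      show False
      proof (cases "b * q \<le> n")
        case True
        show False
          using fits_of_small_increment[OF C(1) _ D _ True q] nb b by fastforce
      next
        case False
        \<comment> \<open>A block that starts beyond the last vertex constrains nothing.\<close>
        have "fits n q D b 0"
          unfolding fits_def
        proof (intro conjI allI impI)
          fix u assume "u div q = b \<and> u < n"
          then have "b * q < n" using div_times_less_eq_dividend[of u q] by auto
          then show "0 \<le> D u" "D u < 0 + alphabet n q (b div q)" using False by auto
        qed simp
        then show False using b by blast
      qed
    qed
  qed
  then have "card {b. b < q\<^sup>2 \<and> exceptional n q D b} \<le> card ({..<2 * q} \<union> ?L)"
    by (intro card_mono) auto
  also have "\<dots> \<le> 2 * q + card ?L" using card_Un_le[of "{..<2 * q}" ?L] by simp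
  also have "\<dots> \<le> 3 * q" using few_large_increments[OF C q] by simp
  finally show ?thesis .
qed

subsection \<open>Spill chains\<close>

text \<open>Room for \<open>q\<close> copies of the spill values puts the quota between
  \<open>q\<close> and \<open>2 * q\<close>, so both roundings lose only \<open>O(1/q)\<close> bits
  per letter.\<close>

definition cell_width :: "nat \<Rightarrow> nat \<Rightarrow> nat" where
  "cell_width q s = (LEAST k. q * s \<le> 2 ^ k)"

text \<open>The number of values allowed for a spill, 1 in front of the first letter. It depends on
  the format only, so chains with equal window size share a table.\<close>

fun spill :: "nat \<Rightarrow> nat \<Rightarrow> nat \<Rightarrow> nat" where
  "spill X q 0 = 1"
| "spill X q (Suc i) = (X - 1) div (2 ^ cell_width q (spill X q i) div spill X q i) + 1"

definition width :: "nat \<Rightarrow> nat \<Rightarrow> nat \<Rightarrow> nat" where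
  "width X q i = cell_width q (spill X q i)"

definition quota :: "nat \<Rightarrow> nat \<Rightarrow> nat \<Rightarrow> nat" where
  "quota X q i = 2 ^ width X q i div spill X q i"

definition offset :: "nat \<Rightarrow> nat \<Rightarrow> nat \<Rightarrow> nat" where
  "offset X q i = (\<Sum>j<i. width X q j)"

lemma spill_Suc: "spill X q (Suc i) = (X - 1) div quota X q i + 1"
  by (simp add: quota_def width_def)

declare spill.simps(2) [simp del]

lemma spill_pos: "spill X q i > 0"
  by (cases i) (auto simp: spill_Suc)

lemma width_ge: "q * spill X q i \<le> 2 ^ width X q i"
  unfolding width_def cell_width_def
  by (rule LeastI[of _ "q * spill X q i"]) simp

lemma width_less: "0 < q \<Longrightarrow> 2 ^ width X q i < 2 * (q * spill X q i)"
proof (cases "width X q i")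
  case 0
  assume "0 < q"
  then have "0 < q * spill X q i" using spill_pos by simp
  then show ?thesis using 0 by (simp del: nat_0_less_mult_iff)
next
  case (Suc k)
  then have "\<not> q * spill X q i \<le> 2 ^ k"
    using not_less_Least[of k "\<lambda>k. q * spill X q i \<le> 2 ^ k"]
    unfolding width_def cell_width_def by simp
  then show ?thesis using Suc by simp
qed

lemma width_le:
  assumes "q * spill X q i \<le> 2 ^ w" shows "width X q i \<le> w"
  unfolding width_def cell_width_def by (rule Least_le) (rule assms)

lemma quota_ge: "q \<le> quota X q i"
  unfolding quota_def using width_ge[of q X i] spill_pos[of X q i]
  by (simp add: less_eq_div_iff_mult_less_eq)

lemma quota_less: "0 < q \<Longrightarrow> quota X q i < 2 * q"
  unfolding quota_def using width_less[of q X i]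
  by (simp add: less_mult_imp_div_less mult.assoc)

lemma quota_spill_le: "quota X q i * spill X q i \<le> 2 ^ width X q i"
  unfolding quota_def by simp

lemma spill_Suc_mult_le:
  assumes "q > 0" shows "q * spill X q (Suc i) \<le> X - 1 + q"
proof -
  have "q * ((X - 1) div quota X q i) \<le> quota X q i * ((X - 1) div quota X q i)"
    using quota_ge by (intro mult_right_mono) auto
  also have "\<dots> \<le> X - 1" by simp
  finally show ?thesis by (simp add: spill_Suc)
qed

text \<open>With \<open>X + q\<close> at most \<open>n\<close> this keeps every field within one
  word.\<close>

lemma spill_mult_le: "0 < q \<Longrightarrow> q * spill X q i \<le> X + q"
  using spill_Suc_mult_le[of q X "i - 1"] by (cases i) auto

text \<open>
  Field \<open>i\<close> holds the spill of letter \<open>i - 1\<close> and the remainder of letter \<open>i\<close>.  A chain of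
  \<open>q\<close> letters has \<open>q + 1\<close> fields; the last one only receives a spill.
\<close>

definition spill_val :: "nat \<Rightarrow> nat \<Rightarrow> (nat \<Rightarrow> nat) \<Rightarrow> nat \<Rightarrow> nat" where
  "spill_val X q x i = (case i of 0 \<Rightarrow> 0 | Suc j \<Rightarrow> x j div quota X q j)"

definition cell :: "nat \<Rightarrow> nat \<Rightarrow> (nat \<Rightarrow> nat) \<Rightarrow> nat \<Rightarrow> nat" where
  "cell X q x i = spill_val X q x i + spill X q i * (x i mod quota X q i)"

definition chain :: "nat \<Rightarrow> nat \<Rightarrow> (nat \<Rightarrow> nat) \<Rightarrow> nat" where
  "chain X q x = (\<Sum>i\<le>q. cell X q x i * 2 ^ offset X q i)"

lemma spill_val_less:
  assumes "\<And>i. x i < X" shows "spill_val X q x i < spill X q i"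
proof (cases i)
  case (Suc j)
  have "x j div quota X q j \<le> (X - 1) div quota X q j"
    using assms[of j] by (intro div_le_mono) auto
  then show ?thesis using Suc by (simp add: spill_val_def spill_Suc)
qed (simp add: spill_val_def)

lemma cell_less:
  assumes "\<And>i. x i < X" "0 < q" shows "cell X q x i < 2 ^ width X q i"
proof -
  have "x i mod quota X q i < quota X q i" using quota_ge[of q X i] assms(2) by simp
  then have "Suc (x i mod quota X q i) * spill X q i \<le> quota X q i * spill X q i"
    by (intro mult_right_mono) auto
  then show ?thesis
    using spill_val_less[of x X q i, OF assms(1)] quota_spill_le[of X q i]
    unfolding cell_def by (simp add: algebra_simps)
qed

lemma cell_mod:
  assumes "\<And>i. x i < X" shows "cell X q x i mod spill X q i = spill_val X q x i"
  using spill_val_less[of x X q i, OF assms] by (simp add: cell_def)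

lemma cell_div:
  assumes "\<And>i. x i < X" shows "cell X q x i div spill X q i = x i mod quota X q i"
  using spill_val_less[of x X q i, OF assms] spill_pos[of X q i] by (simp add: cell_def)

lemma cell_decode:
  assumes "\<And>i. x i < X"
  shows "cell X q x (Suc i) mod spill X q (Suc i) * quota X q i + cell X q x i div spill X q i = x i"
  by (simp only: cell_mod[of x X, OF assms] cell_div[of x X, OF assms]) (simp add: spill_val_def)

section \<open>Positional systems with digits of varying width, and bit fields in words\<close>

text \<open>Earlier digits sum to less than the weight of digit \<open>i\<close>; later ones
  contribute multiples of the weight of digit \<open>i + 1\<close>.\<close>

lemma digit_of_sum:
  fixes c k :: "nat \<Rightarrow> nat"
  assumes c: "\<And>i. c i < 2 ^ k i" and i: "i < m"
  shows "(\<Sum>i<m. c i * 2 ^ (\<Sum>j<i. k j)) div 2 ^ (\<Sum>j<i. k j) mod 2 ^ k i = c i"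
proof -
  let ?o = "\<lambda>i. \<Sum>j<i. k j"
  have less: "(\<Sum>i<m. c i * 2 ^ ?o i) < 2 ^ ?o m" for m
  proof (induction m)
    case (Suc m)
    have "Suc (c m) * 2 ^ ?o m \<le> 2 ^ k m * 2 ^ ?o m"
      using c[of m] by (intro mult_right_mono) auto
    then show ?case using Suc by (simp add: power_add mult.commute)
  qed simp
  show ?thesis using i
  proof (induction m)
    case (Suc m)
    show ?case
    proof (cases "i = m")
      case True
      then show ?thesis using less[of m] c[of m] by simp
    next
      case False
      then have im: "i < m" using Suc by simp
      have "?o m = ?o i + (k i + sum k {Suc i..<m})"
        using im sum.atLeastLessThan_concat[of 0 i m k]
        by (simp add: lessThan_atLeast0 flip: sum.atLeast_Suc_lessThan)
      then have "c m * 2 ^ ?o m = 2 ^ ?o i * (2 ^ k i * (c m * 2 ^ sum k {Suc i..<m}))"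
        by (simp add: power_add)
      then show ?thesis using Suc.IH[OF im] by (simp only: sum.lessThan_Suc) simp
    qed
  qed simp
qed

lemma chain_digit:
  assumes "\<And>i. x i < X" "0 < q" "i \<le> q"
  shows "chain X q x div 2 ^ offset X q i mod 2 ^ width X q i = cell X q x i"
  using digit_of_sum[of "cell X q x" "width X q" i "Suc q"] cell_less[of x X q] assms
  unfolding chain_def offset_def by (simp add: lessThan_Suc_atMost)

definition word :: "nat \<Rightarrow> nat \<Rightarrow> nat \<Rightarrow> nat" where
  "word w N l = N div 2 ^ (w * l) mod 2 ^ w"

text \<open>A field of at most \<open>w\<close> bits meets at most two consecutive words. Two shifts
  assemble the \<open>w\<close> bits from \<open>off\<close> on; shifting left and right by
  \<open>w - k\<close> then acts as a mask. For \<open>b = 0\<close> the second word is shifted out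
  entirely.\<close>

lemma read_field:
  fixes N off k w :: nat
  assumes w: "0 < w" and k: "k \<le> w"
  defines "a \<equiv> off div w" and "b \<equiv> off mod w"
  shows "((word w N a div 2 ^ b + word w N (a + 1) * 2 ^ (w - b) mod 2 ^ w) mod 2 ^ w * 2 ^ (w - k) mod 2 ^ w)
    div 2 ^ (w - k) = N div 2 ^ off mod 2 ^ k"
proof -
  define M where "M = N div 2 ^ (w * a)"
  have b: "b < w" using w by (simp add: b_def)
  have off: "off = w * a + b" by (simp add: a_def b_def)
  have W1: "word w N (a + 1) = M div 2 ^ w mod 2 ^ w"
    unfolding word_def M_def by (simp add: power_add mult.commute[of "2 ^ w"] flip: div_mult2_eq)
  have W0: "word w N a = M mod 2 ^ w" by (simp add: word_def M_def)
  have pw: "(2::nat) ^ w = 2 ^ b * 2 ^ (w - b)" using b by (simp flip: power_add)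
  have lo: "M mod 2 ^ w div 2 ^ b = M div 2 ^ b mod 2 ^ (w - b)"
    unfolding pw by (simp add: mod_mult2_eq)
  have hi: "M div 2 ^ w mod 2 ^ w * 2 ^ (w - b) mod 2 ^ w = M div 2 ^ b div 2 ^ (w - b) * 2 ^ (w - b) mod 2 ^ w"
    by (simp add: mod_mult_left_eq pw div_mult2_eq)
  have "(M div 2 ^ b mod 2 ^ (w - b) + M div 2 ^ b div 2 ^ (w - b) * 2 ^ (w - b) mod 2 ^ w) mod 2 ^ w
    = M div 2 ^ b mod 2 ^ w"
    by (simp only: mod_add_right_eq mod_div_mult_eq)
  then have "(word w N a div 2 ^ b + word w N (a + 1) * 2 ^ (w - b) mod 2 ^ w) mod 2 ^ w = N div 2 ^ off mod 2 ^ w"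
    unfolding W0 W1 lo hi by (simp add: M_def off power_add div_mult2_eq)
  moreover have "(2::nat) ^ w = 2 ^ (w - k) * 2 ^ k" using k by (simp flip: power_add)
  moreover have "y mod (2 ^ (w - k) * 2 ^ k) * 2 ^ (w - k) mod (2 ^ (w - k) * 2 ^ k) div 2 ^ (w - k) = y mod 2 ^ k" for y :: nat
    by (simp add: mod_mult_left_eq mult.commute[of _ "2 ^ (w - k)"] mod_mult_mult1 mod_mod_cancel)
  ultimately show ?thesis by simp
qed

section \<open>Bit length of a spill chain\<close>

lemma ln_2_ge_half: "1 / 2 \<le> ln (2::real)"
  using ln_le_minus_one[of "1 / 2"] by (simp add: ln_div)

text \<open>Turns a relative rounding error \<open>t\<close> into bits: \<open>log 2 (1 + t)\<close>
  is at most \<open>t / ln 2\<close>, hence at most \<open>2 * t\<close>.\<close>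

lemma log2_add_le:
  fixes x y :: real
  assumes "0 < x" "0 \<le> y" shows "log 2 (x + y) \<le> log 2 x + 2 * (y / x)"
proof -
  have "x + y = x * (1 + y / x)" using assms by (simp add: field_simps)
  moreover have "1 + y / x > 0" using assms by (simp add: add_pos_nonneg)
  ultimately have "log 2 (x + y) = log 2 x + log 2 (1 + y / x)"
    using assms by (simp add: log_mult)
  moreover have "log 2 (1 + y / x) \<le> (y / x) / ln 2"
    unfolding log_def using assms by (intro divide_right_mono ln_add_one_self_le_self) auto
  moreover have "(y / x) / ln 2 \<le> 2 * (y / x)"
    using ln_2_ge_half assms divide_left_mono[of "1 / 2" "ln 2" "y / x"] by (simp add: mult.commute)
  ultimately show ?thesis by linarith
qed

text \<open>The first loss, from rounding the quota down: one more copy of the spill values would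
  overflow the field, and the quota is at least \<open>q\<close>.\<close>

lemma width_le_log:
  assumes q: "0 < q"
  shows "real (width X q i) \<le> log 2 (quota X q i) + log 2 (spill X q i) + 2 / q"
proof -
  have "2 ^ width X q i < Suc (quota X q i) * spill X q i"
    unfolding quota_def using spill_pos[of X q i] by (simp only: dividend_less_div_times mult_Suc)
  then have "2 ^ width X q i \<le> real (Suc (quota X q i) * spill X q i)"
    by (metis less_imp_le of_nat_le_iff of_nat_numeral of_nat_power)
  then have "real (width X q i) \<le> log 2 (real (Suc (quota X q i) * spill X q i))"
    by (subst le_log_iff) (auto simp: powr_realpow spill_pos simp del: mult_Suc of_nat_Suc)
  also have "\<dots> = log 2 (real (quota X q i) + 1) + log 2 (spill X q i)"
    using spill_pos[of X q i] by (simp add: log_mult add.commute del: mult_Suc)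
  also have "log 2 (real (quota X q i) + 1) \<le> log 2 (quota X q i) + 2 * (1 / quota X q i)"
    using quota_ge[of q X i] q by (intro log2_add_le) auto
  also have "2 * (1 / real (quota X q i)) \<le> 2 * (1 / q)"
    using quota_ge[of q X i] q by (intro mult_left_mono divide_left_mono) auto
  finally show ?thesis by simp
qed

text \<open>The second loss, from rounding the number of quotients up: its relative error
  \<open>Y / X\<close> is at most \<open>2 / q\<close> because \<open>X\<close> is at least
  \<open>q ^ 2\<close>.\<close>

lemma log_spill_Suc_le:
  assumes q: "0 < q" and X: "q\<^sup>2 \<le> X"
  shows "log 2 (spill X q (Suc i)) \<le> log 2 X - log 2 (quota X q i) + 4 / q"
proof -
  let ?Y = "quota X q i"
  have Y: "0 < ?Y" "?Y < 2 * q" using quota_ge[of q X i] quota_less[of q X i] q by auto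
  have X0: "0 < X" using X q by (metis gr0I le_zero_eq power_eq_0_iff not_gr0)
  have "spill X q (Suc i) * ?Y \<le> X + ?Y"
    using le_trans[OF div_times_less_eq_dividend[of "X - 1" ?Y] diff_le_self] by (simp add: spill_Suc)
  then have "real (spill X q (Suc i) * ?Y) \<le> real X + real ?Y"
    by (metis of_nat_add of_nat_le_iff)
  then have "log 2 (spill X q (Suc i) * ?Y) \<le> log 2 (real X + real ?Y)"
    using spill_pos[of X q "Suc i"] Y by simp
  also have "\<dots> \<le> log 2 X + 2 * (?Y / X)" using X0 by (intro log2_add_le) auto
  finally have "log 2 (spill X q (Suc i) * ?Y) \<le> log 2 X + 2 * (?Y / X)" .
  moreover have "real ?Y / X \<le> (2 * q) / (q\<^sup>2)"
  proof (rule frac_le)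
    show "real (q\<^sup>2) \<le> real X" using X by (simp only: of_nat_le_iff)
  qed (use Y q in auto)
  moreover have "(2 * real q) / (q\<^sup>2) = 2 / q" using q by (simp add: power2_eq_square)
  moreover have "log 2 (spill X q (Suc i) * ?Y) = log 2 (spill X q (Suc i)) + log 2 ?Y"
    using spill_pos[of X q "Suc i"] Y by (simp add: log_mult)
  ultimately show ?thesis by simp
qed

text \<open>The pending spill serves as a potential: in the induction step the logarithm of the
  quota cancels, and that of the spill passes on to the next field. The losses \<open>2 / q\<close>
  and \<open>4 / q\<close> add up to \<open>6 / q\<close>.\<close>

lemma offset_le_log:
  assumes q: "0 < q" and X: "q\<^sup>2 \<le> X"
  shows "real (offset X q m) + log 2 (spill X q m) \<le> m * (log 2 X + 6 / q)"
proof (induction m)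
  case (Suc m)
  then show ?case
    using width_le_log[OF q, of X m] log_spill_Suc_le[OF q X, of m]
    by (simp add: offset_def algebra_simps add_divide_distrib)
qed (simp add: offset_def)

text \<open>The losses of \<open>q\<close> letters total 6; the last field is charged a full
  word.\<close>

lemma offset_end_le:
  assumes q: "0 < q" and X: "q\<^sup>2 \<le> X" and w: "width X q q \<le> w"
  shows "real (offset X q (Suc q)) \<le> q * log 2 X + 6 + w"
proof -
  have "log 2 (spill X q q) \<ge> 0" using spill_pos[of X q q] by (simp add: Suc_le_eq)
  moreover have "q * (log 2 X + 6 / q) = q * log 2 X + 6" using q by (simp add: field_simps)
  ultimately show ?thesis using offset_le_log[OF q X, of q] w by (simp add: offset_def)
qed

subsection \<open>The query program\<close>

fun straight :: "instr \<Rightarrow> bool" where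
  "straight (Jump_less _ _ _) = False"
| "straight (Jump_eq _ _ _) = False"
| "straight _ = True"

definition reach :: "nat \<Rightarrow> program \<Rightarrow> nat \<Rightarrow> state \<Rightarrow> state \<Rightarrow> bool" where
  "reach w P t s s' \<longleftrightarrow> (\<exists>k\<le>t. (step w P ^^ k) s = s')"

lemma reach_trans:
  assumes "reach w P t s s'" "reach w P t' s' s''"
  shows "reach w P (t + t') s s''"
proof -
  obtain k k' where "k \<le> t" "(step w P ^^ k) s = s'" "k' \<le> t'" "(step w P ^^ k') s' = s''"
    using assms by (auto simp: reach_def)
  then have "k' + k \<le> t + t'" "(step w P ^^ (k' + k)) s = s''" by (auto simp: funpow_add)
  then show ?thesis unfolding reach_def by blast
qed

lemma reach_step:
  assumes "pc s < length P" shows "reach w P 1 s (exec w (P ! pc s) s)"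
  unfolding reach_def using assms by (intro exI[of _ 1]) (simp add: step_def halted_def)

text \<open>Reduces symbolic execution between two jumps to simplifying a
  \<open>fold\<close>.\<close>

lemma reach_straight:
  assumes "list_all straight cs" "pc s + length cs \<le> length P"
    "\<And>i. i < length cs \<Longrightarrow> P ! (pc s + i) = cs ! i"
  shows "reach w P (length cs) s (fold (exec w) cs s) \<and> pc (fold (exec w) cs s) = pc s + length cs"
  using assms
proof (induction cs arbitrary: s)
  case (Cons c cs)
  let ?s = "exec w c s"
  have pc: "pc ?s = Suc (pc s)" using Cons.prems(1) by (cases c) auto
  have c: "P ! pc s = c" using Cons.prems(3)[of 0] by simp
  have "reach w P 1 s ?s" using reach_step[of s P w] Cons.prems(2) by (simp add: c)
  moreover have "reach w P (length cs) ?s (fold (exec w) cs ?s) \<and> pc (fold (exec w) cs ?s) = pc ?s + length cs"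
    using Cons.prems(1,2) Cons.prems(3)[of "Suc _"] pc by (intro Cons.IH) auto
  ultimately show ?case using reach_trans[of w P 1 s ?s "length cs"] pc by simp
qed (auto simp: reach_def)

text \<open>
  Register 6 points to a row \<open>[a, b, w - b, w - k, S, Y]\<close> and register 5 to an array of
  words; the code reads the field of \<open>k\<close> bits at bit \<open>b\<close> of word \<open>a\<close> of the array.
\<close>

definition read_cell_code :: program where
  "read_cell_code =
    [Load 10 6, Op Add 6 6 8, Op Add 10 10 5, Load 11 10, Op Add 10 10 8, Load 12 10,
     Load 13 6, Op Add 6 6 8, Op Shr 11 11 13,
     Load 13 6, Op Add 6 6 8, Op Shl 12 12 13, Op Add 11 11 12,
     Load 13 6, Op Add 6 6 8, Op Shl 11 11 13, Op Shr 11 11 13,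
     Load 13 6, Op Add 6 6 8, Load 14 6, Op Add 6 6 8]"

definition locate_code :: program where
  "locate_code =
    [Const 8 1, Op Sub 0 0 8, Op Div 2 0 1, Op Mod 3 0 1, Const 4 4, Op Mul 2 2 4,
     Op Add 2 2 8, Load 4 2]"

definition row_code :: program where
  "row_code =
    [Op Add 2 2 8, Load 4 2, Op Add 2 2 8, Load 5 2, Op Add 2 2 8, Load 6 2,
     Const 7 6, Op Mul 3 3 7, Op Add 6 6 3]"

definition combine_code :: program where
  "combine_code = [Op Mod 11 11 13, Op Mul 11 11 16, Op Add 11 11 15, Op Add 0 11 4]"

text \<open>
  Registers 8 and 9 hold the constants 1 and 0, so \<open>Jump_eq 9 9\<close> is an unconditional jump.
  A zero in memory cell 0 announces the uncompressed format, in which cell \<open>v\<close> holds the degree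
  of \<open>v\<close>; it is read by the instruction at 72.
\<close>

definition query :: program where
  "query =
    [Load 1 9, Jump_eq 1 9 72] @ locate_code @
    [Jump_eq 4 9 14, Op Add 4 4 3, Load 0 4, Jump_eq 9 9 73] @ row_code @
    read_cell_code @ [Op Div 15 11 13, Op Add 16 14 9] @
    read_cell_code @ combine_code @ [Jump_eq 9 9 73, Load 0 0]"

lemmas code_defs = query_def locate_code_def row_code_def read_cell_code_def combine_code_def

lemma length_query: "length query = 73"
  by (simp add: code_defs)

definition segment :: "nat \<Rightarrow> program \<Rightarrow> bool" where
  "segment p cs \<longleftrightarrow> list_all straight cs \<and> take (length cs) (drop p query) = cs"

lemma segments:
  "segment 0 [Load 1 9]" "segment 2 locate_code" "segment 11 [Op Add 4 4 3, Load 0 4]"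
  "segment 14 row_code" "segment 23 read_cell_code" "segment 44 [Op Div 15 11 13, Op Add 16 14 9]"
  "segment 46 read_cell_code" "segment 67 combine_code" "segment 72 [Load 0 0]"
  by (simp_all add: segment_def code_defs)

lemma code_lengths [simp]:
  "length locate_code = 8" "length row_code = 9" "length read_cell_code = 21" "length combine_code = 4"
  by (simp_all add: code_defs)

lemma query_jumps [simp]:
  "query ! Suc 0 = Jump_eq 1 9 72" "query ! 10 = Jump_eq 4 9 14" "query ! 13 = Jump_eq 9 9 73"
  "query ! 71 = Jump_eq 9 9 73"
  by (simp_all add: code_defs)

definition cell_at :: "nat \<Rightarrow> (nat \<Rightarrow> nat) \<Rightarrow> nat \<Rightarrow> nat \<Rightarrow> nat" where
  "cell_at w m c r =
    ((m (c + m r) div 2 ^ m (r + 1) + m (c + m r + 1) * 2 ^ m (r + 2) mod 2 ^ w) mod 2 ^ w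
      * 2 ^ m (r + 3) mod 2 ^ w) div 2 ^ m (r + 3)"

text \<open>Register 6 ends at the next row, so running the code again reads the adjacent
  field.\<close>

lemma read_cell:
  assumes "regs s 8 = 1" "regs s 6 = r" "regs s 5 = c"
    and "r + 6 < 2 ^ w" "c + mem s r + 1 < 2 ^ w"
  defines "s' \<equiv> fold (exec w) read_cell_code s"
  shows "regs s' 11 = cell_at w (mem s) c r" "regs s' 13 = mem s (r + 4)"
    "regs s' 14 = mem s (r + 5)" "regs s' 6 = r + 6" "mem s' = mem s"
    "\<And>i. i \<notin> {6, 10, 11, 12, 13, 14} \<Longrightarrow> regs s' i = regs s i"
  using assms(1-5)
  by (simp_all add: s'_def read_cell_code_def cell_at_def add.commute)
    (simp_all add: numeral_eq_Suc)

lemma query_segment: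
  assumes "segment p cs" "pc s = p"
  shows "reach w query (length cs) s (fold (exec w) cs s)"
    "pc (fold (exec w) cs s) = p + length cs"
proof -
  have cs: "list_all straight cs" "take (length cs) (drop p query) = cs"
    using assms(1) by (auto simp: segment_def)
  have len: "cs = [] \<or> p + length cs \<le> length query"
    using arg_cong[OF cs(2), of length] by (cases cs) (auto simp: min_def split: if_splits)
  have nth: "query ! (p + i) = cs ! i" if "i < length cs" for i
    using that len cs(2) by (metis Nat.add_leE empty_iff length_0_conv nth_drop nth_take not_less_zero)
  have "reach w query (length cs) s (fold (exec w) cs s) \<and>
    pc (fold (exec w) cs s) = p + length cs"
    using reach_straight[OF cs(1), of s query w] assms(2) len nth by (cases "cs = []") (auto simp: reach_def)
  then show "reach w query (length cs) s (fold (exec w) cs s)"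
    "pc (fold (exec w) cs s) = p + length cs" by auto
qed

lemma query_jump:
  assumes "query ! pc s = Jump_eq a b l" "pc s < 73"
  shows "reach w query 1 s (s\<lparr>pc := if regs s a = regs s b then l else Suc (pc s)\<rparr>)"
  using reach_step[of s query w] assms by (simp add: length_query)

lemma answers_within_reach:
  assumes "reach w query t (init_state d x) s" "pc s = 73" "t \<le> T"
    "regs s 0 = y" "mem s = mem (init_state d x)"
  shows "answers_within w query d x T y"
proof -
  obtain k where "k \<le> t" "(step w query ^^ k) (init_state d x) = s"
    using assms(1) unfolding reach_def by auto
  then show ?thesis
    unfolding answers_within_def using assms
    by (intro exI[of _ k]) (simp add: halted_def length_query)
qed

section \<open>Correctness of the three paths through the program\<close>

lemma query_direct:
  assumes x: "0 < x" "x < length d" and d0: "d ! 0 = 0"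
  shows "answers_within w query d x 100 (d ! x)"
proof -
  let ?s0 = "init_state d x"
  define s1 where "s1 = fold (exec w) [Load 1 9] ?s0"
  have r1: "reach w query 1 ?s0 s1" and pc1: "pc s1 = 1"
    using query_segment[OF segments(1), of ?s0 w] by (simp_all add: s1_def init_state_def)
  have regs1: "regs s1 1 = 0" "regs s1 9 = 0" "regs s1 0 = x" and mem1: "mem s1 = mem ?s0"
    using x d0 by (simp_all add: s1_def init_state_def)
  define s2 where "s2 = s1\<lparr>pc := 72\<rparr>"
  have r2: "reach w query 1 s1 s2"
    using query_jump[of s1 1 9 72 w] pc1 regs1 by (simp add: s2_def)
  define s3 where "s3 = fold (exec w) [Load 0 0] s2"
  have r3: "reach w query 1 s2 s3" and pc3: "pc s3 = 73"
    using query_segment[OF segments(9), of s2 w] by (simp_all add: s3_def s2_def)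
  show ?thesis
    using answers_within_reach[OF reach_trans[OF reach_trans[OF r1 r2] r3] pc3] x regs1 mem1
    by (simp add: s3_def s2_def init_state_def)
qed

text \<open>The prefix common to both kinds of block, up to the jump on the first entry of the
  record. A record has four words, and the records follow the header word.\<close>

lemma query_block:
  assumes q: "d ! 0 = q" "0 < q" and u: "Suc u < 2 ^ w" "2 < w"
    and len: "4 * (u div q) + 4 < length d" "length d < 2 ^ w"
  defines "r \<equiv> 4 * (u div q) + 1"
  obtains s where "reach w query 10 (init_state d (Suc u)) s" "pc s = 10"
    "mem s = mem (init_state d (Suc u))" "regs s 2 = r" "regs s 3 = u mod q" "regs s 4 = d ! r"
    "regs s 8 = 1" "regs s 9 = 0"
proof -
  let ?s0 = "init_state d (Suc u)"
  \<comment> \<open>Keeps the constants 1 and 4 from being truncated.\<close>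
  have w: "2 ^ 3 \<le> (2::nat) ^ w" using u by (intro power_increasing) auto
  define s1 where "s1 = fold (exec w) [Load 1 9] ?s0"
  have r1: "reach w query 1 ?s0 s1" and pc1: "pc s1 = 1"
    using query_segment[OF segments(1), of ?s0 w] by (simp_all add: s1_def init_state_def)
  have regs1: "regs s1 1 = q" "regs s1 9 = 0" "regs s1 0 = Suc u" and mem1: "mem s1 = mem ?s0"
    using len q by (auto simp add: s1_def init_state_def)
  define s2 where "s2 = s1\<lparr>pc := 2\<rparr>"
  have r2: "reach w query 1 s1 s2"
    using query_jump[of s1 1 9 72 w] pc1 regs1 q by (simp add: s2_def numeral_2_eq_2)
  define s3 where "s3 = fold (exec w) locate_code s2"
  have r3: "reach w query 8 s2 s3" and pc3: "pc s3 = 10"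
    using query_segment[OF segments(2), of s2 w] by (simp_all add: s3_def s2_def)
  have regs3: "mem s3 = mem ?s0" "regs s3 2 = r" "regs s3 3 = u mod q" "regs s3 4 = d ! r"
    "regs s3 8 = 1" "regs s3 9 = 0"
    using regs1 mem1 u len w
    by (simp_all add: s3_def s2_def locate_code_def r_def init_state_def mult.commute)
  show ?thesis
    using that[OF _ pc3 regs3] reach_trans[OF reach_trans[OF r1 r2] r3] by simp
qed

lemma query_exceptional:
  assumes q: "d ! 0 = q" "0 < q" and u: "Suc u < 2 ^ w" "2 < w"
    and len: "4 * (u div q) + 4 < length d" "length d < 2 ^ w"
    and p: "d ! (4 * (u div q) + 1) = p" "0 < p" "p + u mod q < length d"
  shows "answers_within w query d (Suc u) 100 (d ! (p + u mod q))"
proof -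
  let ?s0 = "init_state d (Suc u)"
  obtain s where r: "reach w query 10 ?s0 s" and s: "pc s = 10" "mem s = mem ?s0"
    "regs s 3 = u mod q" "regs s 4 = p" "regs s 9 = 0"
    by (rule query_block[OF q u len]) (use p in auto)
  define s1 where "s1 = s\<lparr>pc := 11\<rparr>"
  have r1: "reach w query 1 s s1"
    using query_jump[of s 4 9 14 w] s p by (simp add: s1_def)
  define s2 where "s2 = fold (exec w) [Op Add 4 4 3, Load 0 4] s1"
  have r2: "reach w query 2 s1 s2" and pc2: "pc s2 = 13"
    using query_segment[OF segments(3), of s1 w] by (simp_all add: s2_def s1_def numeral_2_eq_2)
  have s2: "mem s2 = mem ?s0" "regs s2 0 = d ! (p + u mod q)"
    using s p(3) len by (simp_all add: s2_def s1_def init_state_def)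
  define s3 where "s3 = s2\<lparr>pc := 73\<rparr>"
  have r3: "reach w query 1 s2 s3"
    using query_jump[of s2 9 9 73 w] pc2 by (simp add: s3_def)
  show ?thesis
    using answers_within_reach[OF reach_trans[OF reach_trans[OF reach_trans[OF r r1] r2] r3]] s2
    by (simp add: s3_def)
qed

text \<open>The field of the letter supplies the remainder as a quotient by its spill size, the next
  field the spill as a residue. The row of the former is passed first, so its quota is parked in
  register 16.\<close>

lemma query_regular:
  fixes d :: "nat list" and u q w :: nat
  defines "m \<equiv> mem (init_state d (Suc u))" and "r \<equiv> 4 * (u div q) + 1"
  assumes q: "d ! 0 = q" "0 < q" and u: "Suc u < 2 ^ w" "2 < w"
    and len: "4 * (u div q) + 4 < length d" "length d < 2 ^ w"
    and rec: "d ! r = 0" "d ! (r + 1) = A" "d ! (r + 2) = c" "d ! (r + 3) = t"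
    and row: "f = t + 6 * (u mod q)" "f + 12 < 2 ^ w"
    and cells: "c + m f + 1 < 2 ^ w" "c + m (f + 6) + 1 < 2 ^ w"
    and y: "cell_at w m c (f + 6) mod m (f + 10) * m (f + 5) + cell_at w m c f div m (f + 4) = y"
    and res: "A + y < 2 ^ w"
  shows "answers_within w query d (Suc u) 100 (A + y)"
proof -
  let ?s0 = "init_state d (Suc u)"
  obtain s where r: "reach w query 10 ?s0 s" and s: "pc s = 10" "mem s = m"
    "regs s 2 = r" "regs s 3 = u mod q" "regs s 4 = 0" "regs s 8 = 1" "regs s 9 = 0"
    using query_block[OF q u len, folded m_def r_def, unfolded rec(1)] by blast
  define s1 where "s1 = s\<lparr>pc := 14\<rparr>"
  have r1: "reach w query 1 s s1"
    using query_jump[of s 4 9 14 w] s by (simp add: s1_def)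
  define s2 where "s2 = fold (exec w) row_code s1"
  have r2: "reach w query 9 s1 s2" and pc2: "pc s2 = 23"
    using query_segment[OF segments(4), of s1 w] by (simp_all add: s2_def s1_def)
  have w: "2 ^ 3 \<le> (2::nat) ^ w" using u by (intro power_increasing) auto
  have m: "m i = d ! i" if "i < length d" for i using that by (simp add: m_def init_state_def)
  have rm: "m (Suc r) = A" "m (Suc (Suc r)) = c" "m (Suc (Suc (Suc r))) = t"
    using rec(2-4) len m[of "r + 1"] m[of "r + 2"] m[of "r + 3"] by (simp_all add: r_def numeral_eq_Suc)
  have rl: "r + 3 < 2 ^ w" using len by (simp add: r_def)
  have s2: "mem s2 = m" "regs s2 8 = 1" "regs s2 9 = 0" "regs s2 4 = A" "regs s2 5 = c" "regs s2 6 = f"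
    using s rm w rl row by (simp_all add: s2_def s1_def row_code_def mult.commute)
  define s3 where "s3 = fold (exec w) read_cell_code s2"
  have r3: "reach w query 21 s2 s3" and pc3: "pc s3 = 44"
    using query_segment[OF segments(5), of s2 w] pc2 by (simp_all add: s3_def)
  have f6: "f + 6 < 2 ^ w" "f + 6 + 6 < 2 ^ w" using row(2) by linarith+
  note rc3 = read_cell[OF s2(2,6,5) f6(1), unfolded s2(1), OF cells(1), folded s3_def]
  have s3: "regs s3 11 = cell_at w m c f" "regs s3 13 = m (f + 4)" "regs s3 14 = m (f + 5)"
    "regs s3 6 = f + 6" "mem s3 = m" "regs s3 8 = 1" "regs s3 9 = 0" "regs s3 4 = A" "regs s3 5 = c"
    using rc3(1-5) rc3(6)[of 8] rc3(6)[of 9] rc3(6)[of 4] rc3(6)[of 5] s2 by simp_all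
  define s4 where "s4 = fold (exec w) [Op Div 15 11 13, Op Add 16 14 9] s3"
  have r4: "reach w query 2 s3 s4" and pc4: "pc s4 = 46"
    using query_segment[OF segments(6), of s3 w] pc3 by (simp_all add: s4_def numeral_2_eq_2)
  have s4: "regs s4 15 = cell_at w m c f div m (f + 4)" "regs s4 16 = m (f + 5) mod 2 ^ w"
    "regs s4 6 = f + 6" "mem s4 = m" "regs s4 8 = 1" "regs s4 9 = 0" "regs s4 4 = A" "regs s4 5 = c"
    using s3 by (simp_all add: s4_def)
  define s5 where "s5 = fold (exec w) read_cell_code s4"
  have r5: "reach w query 21 s4 s5" and pc5: "pc s5 = 67"
    using query_segment[OF segments(7), of s4 w] pc4 by (simp_all add: s5_def)
  note rc5 = read_cell[OF s4(5,3,8) f6(2), unfolded s4(4), OF cells(2), folded s5_def]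
  have s5: "regs s5 11 = cell_at w m c (f + 6)" "regs s5 13 = m (f + 10)" "mem s5 = m"
    "regs s5 9 = 0" "regs s5 4 = A"
    "regs s5 15 = cell_at w m c f div m (f + 4)" "regs s5 16 = m (f + 5) mod 2 ^ w"
    using rc5(1,2,5) rc5(6)[of 9] rc5(6)[of 4] rc5(6)[of 15] rc5(6)[of 16] s4
    by (simp_all add: add.assoc)
  define s6 where "s6 = fold (exec w) combine_code s5"
  have r6: "reach w query 4 s5 s6" and pc6: "pc s6 = 71"
    using query_segment[OF segments(8), of s5 w] pc5 by (simp_all add: s6_def)
  have "regs s6 0 = (cell_at w m c (f + 6) mod m (f + 10) * (m (f + 5) mod 2 ^ w)
      + cell_at w m c f div m (f + 4) + A) mod 2 ^ w" and mem6: "mem s6 = m"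
    using s5
    by (simp_all add: s6_def combine_code_def mod_add_left_eq)
  \<comment> \<open>The quota was truncated when it was copied by adding zero; modulo
    \<open>2 ^ w\<close> this makes no difference.\<close>
  then have "regs s6 0 = (A + y) mod 2 ^ w"
    unfolding y[symmetric]
    using mod_add_cong[OF mod_mult_right_eq refl, of "cell_at w m c (f + 6) mod m (f + 10)" "m (f + 5)"
      "2 ^ w" "cell_at w m c f div m (f + 4) + A"]
    by (simp only: add.assoc add.commute[of A])
  then have s6: "regs s6 0 = A + y" "mem s6 = m" using res mem6 by auto
  define s7 where "s7 = s6\<lparr>pc := 73\<rparr>"
  have r7: "reach w query 1 s6 s7"
    using query_jump[of s6 9 9 73 w] pc6 by (simp add: s7_def)
  have "reach w query (10 + 1 + 9 + 21 + 2 + 21 + 4 + 1) ?s0 s7"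
    by (rule reach_trans[OF reach_trans[OF reach_trans[OF reach_trans[OF reach_trans[OF
      reach_trans[OF reach_trans[OF r r1] r2] r3] r4] r5] r6] r7])
  then show ?thesis
    by (rule answers_within_reach) (use s6 in \<open>simp_all add: s7_def m_def\<close>)
qed

subsection \<open>Memory layout\<close>

definition base :: "nat \<Rightarrow> nat \<Rightarrow> (nat \<Rightarrow> nat) \<Rightarrow> nat \<Rightarrow> nat" where
  "base n q D b = (if exceptional n q D b then 0 else SOME a. fits n q D b a)"

text \<open>The default 0 is a legal letter, so exceptional and incomplete blocks have chains too
  and all blocks are laid out alike.\<close>

definition letters :: "nat \<Rightarrow> nat \<Rightarrow> (nat \<Rightarrow> nat) \<Rightarrow> nat \<Rightarrow> nat \<Rightarrow> nat" where
  "letters n q D b i =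
    (if \<not> exceptional n q D b \<and> i < q \<and> b * q + i < n then D (b * q + i) - base n q D b else 0)"

lemma fits_base: "\<not> exceptional n q D b \<Longrightarrow> fits n q D b (base n q D b)"
  unfolding base_def exceptional_def by (auto intro: someI_ex)

lemma base_le: "base n q D b \<le> n"
  by (cases "exceptional n q D b") (use fits_base[of n q D b] in \<open>auto simp: fits_def\<close>, simp add: base_def)

lemma letters_less:
  assumes "0 < q" shows "letters n q D b i < alphabet n q (b div q)"
proof (cases "\<not> exceptional n q D b \<and> i < q \<and> b * q + i < n")
  case True
  then have "(b * q + i) div q = b" by simp
  then show ?thesis using True fits_base[of n q D b] unfolding letters_def fits_def by fastforce
next
  case False
  then have "letters n q D b i = 0" unfolding letters_def by meson
  then show ?thesis using assms by (simp add: alphabet_def)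
qed

lemma base_plus_letter:
  assumes "\<not> exceptional n q D (u div q)" "u < n" "0 < q"
  shows "base n q D (u div q) + letters n q D (u div q) (u mod q) = D u"
  using assms fits_base[OF assms(1)] by (auto simp: letters_def fits_def)

text \<open>Storing shift distances relative to \<open>w\<close> spares the program, which does not know \<open>w\<close>, from computing them.\<close>

definition row :: "nat \<Rightarrow> nat \<Rightarrow> nat \<Rightarrow> nat \<Rightarrow> nat list" where
  "row w X q i =
    [offset X q i div w, offset X q i mod w, w - offset X q i mod w, w - width X q i,
     spill X q i, quota X q i]"

text \<open>Decoding letter \<open>q - 1\<close> also reads field \<open>q\<close>, hence
  \<open>Suc q\<close> rows.\<close>

definition table :: "nat \<Rightarrow> nat \<Rightarrow> nat \<Rightarrow> nat list" where
  "table w X q = concat (map (row w X q) [0..<Suc q])"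

text \<open>A read fetches two consecutive words, the first at index at most
  \<open>offset X q (Suc q) div w\<close>; the summand 2 keeps both within the chain.\<close>

definition chain_words :: "nat \<Rightarrow> nat \<Rightarrow> nat \<Rightarrow> (nat \<Rightarrow> nat) \<Rightarrow> nat list" where
  "chain_words w X q x = map (word w (chain X q x)) [0..<offset X q (Suc q) div w + 2]"

lemma cell_at_row:
  assumes w: "0 < w" and q: "0 < q" "i \<le> q" and x: "\<And>i. x i < X" and k: "width X q i \<le> w"
    and row: "\<And>j. j < 6 \<Longrightarrow> m (r + j) = row w X q i ! j"
    and words: "\<And>l. l < length (chain_words w X q x) \<Longrightarrow> m (c + l) = chain_words w X q x ! l"
  shows "cell_at w m c r = cell X q x i"
proof -
  let ?a = "offset X q i div w"
  have "offset X q i \<le> offset X q (Suc q)"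
    unfolding offset_def using q by (intro sum_mono2) auto
  then have "?a \<le> offset X q (Suc q) div w" by (rule div_le_mono)
  then have mem: "m (c + ?a) = word w (chain X q x) ?a" "m (c + ?a + 1) = word w (chain X q x) (?a + 1)"
    using words[of ?a] words[of "?a + 1"] by (auto simp: chain_words_def simp del: upt_Suc)
  have "m r = ?a" "m (r + 1) = offset X q i mod w" "m (r + 2) = w - offset X q i mod w"
    "m (r + 3) = w - width X q i"
    using row[of 0] row[of 1] row[of 2] row[of 3] by (simp_all add: row_def numeral_eq_Suc)
  then show ?thesis
    unfolding cell_at_def using mem read_field[OF w k, of "chain X q x" "offset X q i"] chain_digit[OF x q]
    by simp
qed

section \<open>Addressing within concatenated lists\<close>

definition start :: "'a list list \<Rightarrow> nat \<Rightarrow> nat" where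
  "start xss k = sum_list (map length (take k xss))"

lemma concat_nth_start:
  assumes "k < length xss" "i < length (xss ! k)"
  shows "start xss k + i < length (concat xss) \<and> concat xss ! (start xss k + i) = xss ! k ! i"
  using assms
proof (induction xss arbitrary: k)
  case (Cons xs xss)
  then show ?case
  proof (cases k)
    case (Suc k')
    then have "start xss k' + i < length (concat xss) \<and> concat xss ! (start xss k' + i) = xss ! k' ! i"
      using Cons by simp
    then show ?thesis using Suc by (simp add: start_def nth_append add.assoc)
  qed (simp add: start_def nth_append)
qed simp

lemma sum_list_const_upt:
  assumes "\<And>i. i < m \<Longrightarrow> f i = (c::nat)" shows "(\<Sum>i\<leftarrow>[0..<m]. f i) = c * m"
  using assms by (induction m) auto

lemma concat_map_nth:
  assumes "\<And>i. i < m \<Longrightarrow> length (f i) = c" and ij: "i < m" "j < c"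
  shows "c * i + j < c * m" "concat (map f [0..<m]) ! (c * i + j) = f i ! j"
proof -
  have "start (map f [0..<m]) i = c * i"
    using sum_list_const_upt[of i "\<lambda>i. length (f i)" c] assms(1) ij by (simp add: start_def take_map comp_def)
  then show "concat (map f [0..<m]) ! (c * i + j) = f i ! j"
    using concat_nth_start[of i "map f [0..<m]" j] assms by simp
  have "c * i + j < c * Suc i" using ij by simp
  also have "\<dots> \<le> c * m" using ij by (intro mult_le_mono2) simp
  finally show "c * i + j < c * m" .
qed

lemma length_concat_map:
  "(\<And>i. i < m \<Longrightarrow> length (f i) = c) \<Longrightarrow> length (concat (map f [0..<m])) = c * m"
  using sum_list_const_upt[of m "\<lambda>i. length (f i)" c] by (simp add: length_concat comp_def)

text \<open>Regular blocks get an empty verbatim part, so that the index of each part is a fixed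
  expression in the block.\<close>

definition parts :: "nat \<Rightarrow> nat \<Rightarrow> nat \<Rightarrow> (nat \<Rightarrow> nat) \<Rightarrow> nat list list" where
  "parts w n q D =
    map (\<lambda>j. table w (alphabet n q j) q) [0..<q] @
    map (\<lambda>b. chain_words w (alphabet n q (b div q)) q (letters n q D b)) [0..<q\<^sup>2] @
    map (\<lambda>b. if exceptional n q D b then map D [b * q..<b * q + q] else []) [0..<q\<^sup>2]"

definition pointer :: "nat \<Rightarrow> nat \<Rightarrow> nat \<Rightarrow> (nat \<Rightarrow> nat) \<Rightarrow> nat \<Rightarrow> nat" where
  "pointer w n q D k = 1 + 4 * q\<^sup>2 + start (parts w n q D) k"

text \<open>Pointers are positive, as they lead behind the records; a zero can thus mark a regular
  block.\<close>

definition block_record :: "nat \<Rightarrow> nat \<Rightarrow> nat \<Rightarrow> (nat \<Rightarrow> nat) \<Rightarrow> nat \<Rightarrow> nat list" where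
  "block_record w n q D b =
    [if exceptional n q D b then pointer w n q D (q + q\<^sup>2 + b) else 0, base n q D b,
     pointer w n q D (q + b), pointer w n q D (b div q)]"

text \<open>
  The pointers depend only on the lengths of the parts, so the records can precede the parts.
\<close>

definition layout :: "nat \<Rightarrow> nat \<Rightarrow> nat \<Rightarrow> (nat \<Rightarrow> nat) \<Rightarrow> nat list" where
  "layout w n q D =
    q # concat (map (block_record w n q D) [0..<q\<^sup>2]) @ concat (parts w n q D)"

lemma length_parts: "length (parts w n q D) = q + 2 * q\<^sup>2"
  by (simp add: parts_def)

lemma parts_nth:
  "j < q \<Longrightarrow> parts w n q D ! j = table w (alphabet n q j) q"
  "b < q\<^sup>2 \<Longrightarrow> parts w n q D ! (q + b) = chain_words w (alphabet n q (b div q)) q (letters n q D b)"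
  "b < q\<^sup>2 \<Longrightarrow> parts w n q D ! (q + q\<^sup>2 + b) =
    (if exceptional n q D b then map D [b * q..<b * q + q] else [])"
  by (simp_all add: parts_def nth_append)

lemma length_records:
  "length (concat (map (block_record w n q D) [0..<q\<^sup>2])) = 4 * q\<^sup>2"
  by (rule length_concat_map) (simp add: block_record_def)

lemma layout_0: "layout w n q D ! 0 = q"
  by (simp add: layout_def)

lemma layout_record:
  assumes "b < q\<^sup>2" "j < 4"
  shows "4 * b + 1 + j < length (layout w n q D)"
    "layout w n q D ! (4 * b + 1 + j) = block_record w n q D b ! j"
  using concat_map_nth[of "q\<^sup>2" "block_record w n q D" 4 b j] assms
  by (simp_all add: layout_def length_records nth_append block_record_def)

lemma layout_part:
  assumes "k < q + 2 * q\<^sup>2" "i < length (parts w n q D ! k)"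
  shows "pointer w n q D k + i < length (layout w n q D)"
    "layout w n q D ! (pointer w n q D k + i) = parts w n q D ! k ! i"
  using concat_nth_start[of k "parts w n q D" i] assms
  by (simp_all add: layout_def length_records nth_append pointer_def length_parts)

lemma table_nth:
  assumes "i \<le> q" "j < 6"
  shows "6 * i + j < length (table w X q)" "table w X q ! (6 * i + j) = row w X q i ! j"
  using concat_map_nth[of "Suc q" "row w X q" 6 i j] length_concat_map[of "Suc q" "row w X q" 6] assms
  by (simp_all add: table_def row_def del: upt_Suc)

text \<open>The maximum in \<open>alphabet\<close> leaves a slack of \<open>q ^ 2\<close>, enough
  for the extra \<open>q\<close> in \<open>spill_mult_le\<close>.\<close>

lemma width_alphabet_le:
  assumes "0 < q" "2 * q\<^sup>2 \<le> n" "n < 2 ^ w" "i \<le> q"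
  shows "width (alphabet n q j) q i \<le> w"
proof (rule width_le)
  have "alphabet n q j + q \<le> n - 2 * q\<^sup>2 + q\<^sup>2 + q"
    unfolding alphabet_def by (simp add: diff_le_mono2)
  also have "q \<le> q\<^sup>2" using assms(1) by (simp add: power2_eq_square)
  then have "n - 2 * q\<^sup>2 + q\<^sup>2 + q \<le> n" using assms(2) by linarith
  finally show "q * spill (alphabet n q j) q i \<le> 2 ^ w"
    using spill_mult_le[OF assms(1), of "alphabet n q j" i] assms(3) by simp
qed

lemma block_less:
  fixes u n q :: nat
  assumes "u < n" "n \<le> q ^ 3" shows "u div q < q\<^sup>2"
proof -
  have "q ^ 3 = q\<^sup>2 * q" by (simp add: power3_eq_cube power2_eq_square)
  then have "u < q\<^sup>2 * q" using assms by simp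
  then show ?thesis by (simp add: less_mult_imp_div_less)
qed

lemma layout_answers:
  assumes q: "0 < q" "2 * q\<^sup>2 \<le> n" "n \<le> q ^ 3" and w: "n < 2 ^ w" "2 < w"
    and len: "length (layout w n q D) \<le> n" and D: "\<And>u. D u < n" and u: "u < n"
  shows "answers_within w query (layout w n q D) (Suc u) 100 (D u)"
proof -
  define d where "d = layout w n q D"
  define b where "b = u div q"
  define i where "i = u mod q"
  have b: "b < q\<^sup>2" using block_less[OF u q(3)] by (simp add: b_def)
  then have bq: "b div q < q" by (simp add: less_mult_imp_div_less power2_eq_square)
  have i: "i < q" using q by (simp add: i_def)
  have bi: "b * q + i = u" by (simp add: b_def i_def)
  have rec: "d ! (4 * b + 1) = block_record w n q D b ! 0" "d ! (4 * b + 1 + 1) = block_record w n q D b ! 1"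
    "d ! (4 * b + 1 + 2) = block_record w n q D b ! 2" "d ! (4 * b + 1 + 3) = block_record w n q D b ! 3"
    using layout_record(2)[OF b, of 0 w n D] layout_record(2)[OF b, of 1 w n D]
      layout_record(2)[OF b, of 2 w n D] layout_record(2)[OF b, of 3 w n D]
    unfolding d_def by simp_all
  have len': "4 * (u div q) + 4 < length d" "length d < 2 ^ w"
    using layout_record(1)[OF b, of 3 w n D] len w by (simp_all add: d_def b_def)
  have u': "Suc u < 2 ^ w" using u w by simp
  have d0: "d ! 0 = q" by (simp add: d_def layout_0)
  show ?thesis
  proof (cases "exceptional n q D b")
    case True
    let ?k = "q + q\<^sup>2 + b"
    have "pointer w n q D ?k + i < length d" "d ! (pointer w n q D ?k + i) = D u"
      using layout_part[of ?k q i w n D] b i True bi unfolding d_def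
      by (simp_all add: parts_nth)
    then show ?thesis
      using query_exceptional[OF d0 q(1) u' w(2) len', of "pointer w n q D ?k"] True rec(1)
      by (simp add: block_record_def pointer_def b_def i_def d_def)
  next
    case False
    define X where "X = alphabet n q (b div q)"
    define x where "x = letters n q D b"
    define c where "c = pointer w n q D (q + b)"
    define t where "t = pointer w n q D (b div q)"
    define m where "m = mem (init_state d (Suc u))"
    have m: "m l = d ! l" if "l < length d" for l using that by (simp add: m_def init_state_def)
    have x: "x i < X" for i unfolding x_def X_def using letters_less[OF q(1)] .
    have words: "c + l < length d \<and> m (c + l) = chain_words w X q x ! l" if "l < length (chain_words w X q x)" for l
      using layout_part[of "q + b" q l w n D] b that m[of "c + l"]
      by (simp add: parts_nth X_def x_def c_def d_def)
    have tab: "t + 6 * i' + j < length d \<and> m (t + 6 * i' + j) = row w X q i' ! j" if "i' \<le> q" "j < 6" for i' j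
      using layout_part[of "b div q" q "6 * i' + j" w n D] bq table_nth[OF that] m[of "t + 6 * i' + j"]
      by (simp add: parts_nth X_def t_def d_def add.assoc)
    have cell: "cell_at w m c (t + 6 * i') = cell X q x i'"
      and addr: "c + m (t + 6 * i') + 1 < length d" if i': "i' \<le> q" for i'
    proof -
      show "cell_at w m c (t + 6 * i') = cell X q x i'"
        using w q i' x words tab[OF i'] width_alphabet_le[OF q(1,2) w(1) i'] unfolding X_def
        by (intro cell_at_row) auto
      have "offset X q i' \<le> offset X q (Suc q)"
        unfolding offset_def using i' by (intro sum_mono2) auto
      then have "offset X q i' div w \<le> offset X q (Suc q) div w" by (rule div_le_mono)
      then show "c + m (t + 6 * i') + 1 < length d"
        using words[of "offset X q i' div w + 1"] tab[OF i', of 0]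
        by (simp add: row_def chain_words_def)
    qed
    define f where "f = t + 6 * i"
    have f6: "f + 6 = t + 6 * Suc i" by (simp add: f_def)
    have mf: "m (f + 4) = spill X q i" "m (f + 5) = quota X q i" "m (f + 10) = spill X q (Suc i)"
      using tab[of i 4] tab[of i 5] tab[of "Suc i" 4] i by (simp_all add: f_def row_def eval_nat_numeral)
    have "answers_within w query d (Suc u) 100 (base n q D b + x i)"
    proof (rule query_regular[OF d0 q(1) u' w(2) len', folded m_def, where c=c and t=t and f=f])
      show "d ! (4 * (u div q) + 1) = 0" "d ! (4 * (u div q) + 1 + 1) = base n q D b"
        "d ! (4 * (u div q) + 1 + 2) = c" "d ! (4 * (u div q) + 1 + 3) = t"
        using rec False by (simp_all add: block_record_def b_def c_def t_def)
      show "f = t + 6 * (u mod q)" by (simp add: f_def i_def)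
      \<comment> \<open>The next row ends at address \<open>f + 11\<close>, inside the data
        structure.\<close>
      show "f + 12 < 2 ^ w" using tab[of "Suc i" 5] i len' by (simp add: f_def)
      show "c + m f + 1 < 2 ^ w" "c + m (f + 6) + 1 < 2 ^ w"
        using addr[of i] addr[of "Suc i"] i len' unfolding f6 by (simp_all add: f_def)
      show "cell_at w m c (f + 6) mod m (f + 10) * m (f + 5) + cell_at w m c f div m (f + 4) = x i"
        using cell[of i] cell[of "Suc i"] i mf cell_decode[of x X q i, OF x]
        unfolding f6 by (simp add: f_def)
      show "base n q D b + x i < 2 ^ w"
        using base_plus_letter[of n q D u] False u q D[of u] w by (simp add: b_def i_def x_def)
    qed
    then show ?thesis
      using base_plus_letter[of n q D u] False u q by (simp add: b_def i_def x_def d_def)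
  qed
qed

subsection \<open>Space\<close>

lemma start_le: "start xss k \<le> length (concat xss)"
proof -
  have "length (concat xss) = start xss k + sum_list (map length (drop k xss))"
    unfolding start_def length_concat
    by (metis append_take_drop_id map_append sum_list_append)
  then show ?thesis by simp
qed

lemma pointer_le: "pointer w n q D k \<le> length (layout w n q D)"
  using start_le[of "parts w n q D" k] by (simp add: pointer_def layout_def length_records)

lemma alphabet_add_le:
  assumes "2 * q\<^sup>2 \<le> n" shows "alphabet n q j + q \<le> n"
proof -
  have "alphabet n q j \<le> n - 2 * q\<^sup>2 + q\<^sup>2"
    unfolding alphabet_def by (simp add: diff_le_mono2)
  moreover have "q \<le> q\<^sup>2" by (simp add: power2_eq_square)
  ultimately show ?thesis using assms by linarith
qed

lemma row_words:
  assumes q: "0 < q" "2 * q\<^sup>2 \<le> n" and w: "n < 2 ^ w" "0 < w"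
    and i: "i \<le> q" and o: "offset (alphabet n q j) q (Suc q) div w \<le> n"
    and z: "z \<in> set (row w (alphabet n q j) q i)"
  shows "z < 2 ^ w"
proof -
  let ?X = "alphabet n q j"
  have "offset ?X q i \<le> offset ?X q (Suc q)"
    unfolding offset_def using i by (intro sum_mono2) auto
  then have "offset ?X q i div w \<le> n" using o by (meson div_le_mono le_trans)
  moreover have "spill ?X q i \<le> n"
  proof -
    have "spill ?X q i \<le> q * spill ?X q i" using q by simp
    then show ?thesis using spill_mult_le[OF q(1), of ?X i] alphabet_add_le[OF q(2), of j] by linarith
  qed
  moreover have "quota ?X q i \<le> n"
  proof -
    have "q \<le> q\<^sup>2" by (simp add: power2_eq_square)
    then show ?thesis using quota_less[OF q(1), of ?X i] q by simp
  qed
  moreover have "offset ?X q i mod w \<le> w" using w by (simp add: less_imp_le)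
  ultimately have "z \<le> n \<or> z \<le> w" using z by (auto simp: row_def)
  then show ?thesis using w less_exp[of w] by linarith
qed

lemma layout_words:
  assumes q: "0 < q" "2 * q\<^sup>2 \<le> n" and w: "n < 2 ^ w" "0 < w"
    and len: "length (layout w n q D) \<le> n" and D: "\<And>u. D u < n"
    and z: "z \<in> set (layout w n q D)"
  shows "z < 2 ^ w"
proof -
  have qn: "q \<le> n" using alphabet_add_le[OF q(2), of 0] by simp
  consider "z = q" | b where "z \<in> set (block_record w n q D b)"
    | j where "j < q" "z \<in> set (table w (alphabet n q j) q)"
    | X x where "z \<in> set (chain_words w X q x)" | u where "z = D u"
    using z unfolding layout_def parts_def by (auto split: if_splits)
  then show ?thesis
  proof cases
    case 1
    then show ?thesis using qn w by simp
  next
    case 2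
    then have "z \<le> n"
      using pointer_le[of w n q D] len base_le[of n q D] unfolding block_record_def
      by (auto split: if_splits intro: le_trans)
    then show ?thesis using w by simp
  next
    case 3
    \<comment> \<open>The offsets in table \<open>j\<close> are bounded through block
      \<open>j * q\<close>, the first of superblock \<open>j\<close>: its chain has more words than
      its bit length divided by \<open>w\<close>, and it lies in the layout.\<close>
    have jq: "j * q < q\<^sup>2" using 3 q by (simp add: power2_eq_square)
    have "parts w n q D ! (q + j * q) = chain_words w (alphabet n q j) q (letters n q D (j * q))"
      using parts_nth(2)[OF jq, of w n D] q by simp
    then have "offset (alphabet n q j) q (Suc q) div w \<le> length (layout w n q D)"
      using layout_part(1)[of "q + j * q" q "offset (alphabet n q j) q (Suc q) div w" w n D] jq
      by (simp add: chain_words_def)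
    then have o: "offset (alphabet n q j) q (Suc q) div w \<le> n" using len by simp
    obtain i where "i \<le> q" "z \<in> set (row w (alphabet n q j) q i)"
      using 3 by (auto simp: table_def less_Suc_eq_le simp del: upt_Suc)
    then show ?thesis using row_words[OF q w _ o] by blast
  next
    case 4
    then show ?thesis by (auto simp: chain_words_def word_def)
  next
    case 5
    then show ?thesis using D[of u] w by simp
  qed
qed

lemma length_layout:
  "length (layout w n q D) = 1 + 4 * q\<^sup>2 + q * (6 * Suc q)
    + (\<Sum>b<q\<^sup>2. offset (alphabet n q (b div q)) q (Suc q) div w + 2)
    + q * card {b. b < q\<^sup>2 \<and> exceptional n q D b}"
proof -
  have t: "length (table w X q) = 6 * Suc q" for X
    unfolding table_def by (rule length_concat_map) (simp add: row_def)
  have upt: "(\<Sum>b\<leftarrow>[0..<m]. f b) = (\<Sum>b<m. f b)" for f :: "nat \<Rightarrow> nat" and m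
    by (simp add: sum_list_distinct_conv_sum_set lessThan_atLeast0)
  have "(\<Sum>b<q\<^sup>2. length (if exceptional n q D b then map D [b * q..<b * q + q] else []))
    = (\<Sum>b<q\<^sup>2. if exceptional n q D b then q else 0)"
    by (intro sum.cong) auto
  also have "\<dots> = q * card {b. b < q\<^sup>2 \<and> exceptional n q D b}"
    by (subst sum.If_cases) (auto simp: Int_def lessThan_def mult.commute)
  finally show ?thesis
    by (simp add: layout_def length_records parts_def length_concat comp_def t upt chain_words_def
        block_record_def del: upt_Suc)
qed

section \<open>Factorials and sums of logarithms\<close>

lemma fact_add_le: "fact (n + m) \<le> fact n * (n + m) ^ m" for n m :: nat
proof (induction m)
  case (Suc m)
  have "fact (n + Suc m) = (n + Suc m) * fact (n + m)" by simp
  also have "\<dots> \<le> (n + Suc m) * (fact n * (n + m) ^ m)" using Suc by (rule mult_le_mono2)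
  also have "\<dots> \<le> (n + Suc m) * (fact n * (n + Suc m) ^ m)"
    by (intro mult_le_mono2 power_mono) auto
  finally show ?case by (simp add: mult.commute mult.left_commute)
qed simp

lemma prod_add_le: "(\<Prod>i<n. Suc i + m) \<le> fact n * (n + m) ^ m" for n m :: nat
proof -
  have "(\<Prod>i<n. Suc i + m) * fact m = fact (n + m)"
    by (induction n) (simp_all add: algebra_simps)
  then have "(\<Prod>i<n. Suc i + m) \<le> fact (n + m)"
    by (metis fact_ge_1 mult_le_mono2 nat_mult_1_right)
  then show ?thesis using fact_add_le le_trans by blast
qed

text \<open>The logarithms add up to that of a rising factorial, so widening every window by
  \<open>m\<close> costs \<open>m\<close> logarithms in total, not one per window.\<close>

lemma sum_log_le:
  assumes "0 < n"
  shows "(\<Sum>u<n. log 2 (real (n - u + m))) \<le> log 2 (fact n) + m * log 2 (real (n + m))"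
proof -
  have "(\<Sum>u<n. log 2 (real (n - u + m))) = (\<Sum>i<n. log 2 (real (Suc i + m)))"
    by (subst sum.nat_diff_reindex[symmetric]) (intro sum.cong; simp add: Suc_diff_Suc)
  also have "\<dots> = log 2 (\<Prod>i<n. real (Suc i + m))"
    by (induction n) (simp_all add: log_mult prod_pos del: of_nat_Suc of_nat_add add_Suc)
  also have "\<dots> = log 2 (real (\<Prod>i<n. Suc i + m))" by (simp only: of_nat_prod)
  also have "\<dots> \<le> log 2 (real (fact n * (n + m) ^ m))"
    using prod_add_le[where n=n and m=m] assms
    by (subst log_le_cancel_iff) (auto simp only: of_nat_le_iff of_nat_0_less_iff intro!: prod_pos mult_pos_pos zero_less_power fact_gt_zero)
  also have "\<dots> = log 2 (fact n) + m * log 2 (real (n + m))"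
    using assms by (simp add: log_mult log_nat_power del: of_nat_add)
  finally show ?thesis .
qed

text \<open>A window exceeds \<open>n - u\<close> by at most \<open>2 * q ^ 2\<close>: half is the
  summand in \<open>alphabet\<close>, half arises because the size is constant on
  \<open>q ^ 2\<close> vertices. The last term charges \<open>w\<close> bits to each position from
  \<open>n\<close> up to \<open>q ^ 3\<close>.\<close>

lemma sum_log_alphabet_le:
  assumes q: "0 < q" "2 * q\<^sup>2 \<le> n" "n \<le> q ^ 3" and w: "n < 2 ^ w"
  shows "(\<Sum>b<q\<^sup>2. q * log 2 (alphabet n q (b div q)))
    \<le> log 2 (fact n) + real (2 * q\<^sup>2 * (w + 1)) + real ((q ^ 3 - n) * w)"
proof -
  have n: "0 < n" using q(2) zero_less_power[OF q(1), of 2] by linarith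
  have logw: "log 2 (real m) \<le> k" if "m \<le> 2 ^ k" "0 < m" for m k :: nat
    using that by (subst log_le_iff) (auto simp: powr_realpow)
  let ?f = "\<lambda>u. log 2 (real (alphabet n q (u div q div q)))"
  have "(\<Sum>b<q\<^sup>2. q * log 2 (alphabet n q (b div q))) = (\<Sum>b<q\<^sup>2. \<Sum>u\<in>{b * q..<b * q + q}. ?f u)"
  proof (rule sum.cong)
    fix b
    have "(\<Sum>u\<in>{b * q..<b * q + q}. ?f u) = (\<Sum>u\<in>{b * q..<b * q + q}. log 2 (real (alphabet n q (b div q))))"
    proof (rule sum.cong)
      fix u assume "u \<in> {b * q..<b * q + q}"
      then have "u div q = b" using q by (auto intro!: div_nat_eqI simp: mult.commute)
      then show "?f u = log 2 (real (alphabet n q (b div q)))" by simp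
    qed simp
    then show "q * log 2 (alphabet n q (b div q)) = (\<Sum>u\<in>{b * q..<b * q + q}. ?f u)" by simp
  qed simp
  also have "\<dots> = (\<Sum>u<q\<^sup>2 * q. ?f u)" by (rule sum.nat_group)
  also have "q\<^sup>2 * q = q ^ 3" by (simp add: power2_eq_square power3_eq_cube)
  finally have split: "(\<Sum>b<q\<^sup>2. q * log 2 (alphabet n q (b div q))) = (\<Sum>u<q ^ 3. ?f u)" .
  have "(\<Sum>u<q ^ 3. ?f u) = (\<Sum>u<n. ?f u) + (\<Sum>u\<in>{n..<q ^ 3}. ?f u)"
    using sum.atLeastLessThan_concat[of 0 n "q ^ 3" ?f] q by (simp add: lessThan_atLeast0)
  moreover have "(\<Sum>u<n. ?f u) \<le> (\<Sum>u<n. log 2 (real (n - u + 2 * q\<^sup>2)))"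
  proof (rule sum_mono)
    fix u assume "u \<in> {..<n}"
    have "u < Suc (u div q div q) * q\<^sup>2"
      using dividend_less_div_times[of "q\<^sup>2" u] q
      by (simp add: power2_eq_square div_mult2_eq add.commute)
    then have "u < u div q div q * q\<^sup>2 + q\<^sup>2" by simp
    moreover have "n - max (u div q div q) 2 * q\<^sup>2 \<le> n - u div q div q * q\<^sup>2"
      by (intro diff_le_mono2 mult_right_mono) auto
    ultimately have "alphabet n q (u div q div q) \<le> n - u + 2 * q\<^sup>2"
      unfolding alphabet_def using \<open>u \<in> {..<n}\<close> by simp
    moreover have "0 < alphabet n q (u div q div q)" using q by (simp add: alphabet_def)
    ultimately show "?f u \<le> log 2 (real (n - u + 2 * q\<^sup>2))"
      by (subst log_le_cancel_iff) (auto simp del: of_nat_add)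
  qed
  moreover have "(\<Sum>u<n. log 2 (real (n - u + 2 * q\<^sup>2)))
      \<le> log 2 (fact n) + real (2 * q\<^sup>2) * log 2 (real (n + 2 * q\<^sup>2))"
    by (rule sum_log_le[OF n])
  \<comment> \<open>\<open>n + 2 * q ^ 2\<close> is at most \<open>2 * n\<close>, whose logarithm is
    below \<open>w + 1\<close>.\<close>
  moreover have "real (2 * q\<^sup>2) * log 2 (real (n + 2 * q\<^sup>2)) \<le> real (2 * q\<^sup>2) * real (w + 1)"
    using q w n by (intro mult_left_mono logw) auto
  moreover have "(\<Sum>u\<in>{n..<q ^ 3}. ?f u) \<le> (\<Sum>u\<in>{n..<q ^ 3}. real w)"
  proof (rule sum_mono)
    fix u
    have "alphabet n q (u div q div q) \<le> 2 ^ w"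
      using alphabet_add_le[OF q(2), of "u div q div q"] w by simp
    then show "?f u \<le> real w" using q by (intro logw) (auto simp: alphabet_def)
  qed
  moreover have "(\<Sum>u\<in>{n..<q ^ 3}. real w) = real ((q ^ 3 - n) * w)" by simp
  ultimately show ?thesis unfolding split of_nat_mult[of "2 * q\<^sup>2"] by linarith
qed

lemma layout_space:
  assumes q: "0 < q" "2 * q\<^sup>2 \<le> n" "n \<le> q ^ 3" "q ^ 3 \<le> n + 3 * q\<^sup>2" and w: "n < 2 ^ w" "0 < w"
    and exc: "card {b. b < q\<^sup>2 \<and> exceptional n q D b} \<le> 3 * q"
  shows "real (w * length (layout w n q D)) \<le> log 2 (fact n) + 40 * (real q)\<^sup>2 * w"
proof -
  let ?X = "\<lambda>b. alphabet n q (b div q)"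
  have qq: "q \<le> q\<^sup>2" "1 \<le> q\<^sup>2" using q by (simp_all add: power2_eq_square Suc_le_eq)
  have "q * card {b. b < q\<^sup>2 \<and> exceptional n q D b} \<le> 3 * q\<^sup>2"
    using mult_le_mono2[OF exc, of q] by (simp add: power2_eq_square)
  moreover have "q * (6 * Suc q) = 6 * q\<^sup>2 + 6 * q"
    by (simp add: power2_eq_square algebra_simps)
  \<comment> \<open>20 is 1 for the header, 4 for the records, 12 for the tables and 3 for the
    verbatim degrees.\<close>
  ultimately have "length (layout w n q D) \<le> 20 * q\<^sup>2 + (\<Sum>b<q\<^sup>2. offset (?X b) q (Suc q) div w + 2)"
    unfolding length_layout using qq by linarith
  then have "w * length (layout w n q D)
    \<le> w * (20 * q\<^sup>2 + (\<Sum>b<q\<^sup>2. offset (?X b) q (Suc q) div w + 2))"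
    by (rule mult_le_mono2)
  also have "\<dots> = 20 * q\<^sup>2 * w + (\<Sum>b<q\<^sup>2. w * (offset (?X b) q (Suc q) div w) + 2 * w)"
    by (simp add: sum_distrib_left distrib_left mult.commute sum.distrib)
  also have "\<dots> \<le> 20 * q\<^sup>2 * w + (\<Sum>b<q\<^sup>2. offset (?X b) q (Suc q) + 2 * w)"
    by (intro add_mono sum_mono order_refl) simp
  finally have "real (w * length (layout w n q D))
    \<le> real (20 * q\<^sup>2 * w + (\<Sum>b<q\<^sup>2. offset (?X b) q (Suc q) + 2 * w))"
    by (simp only: of_nat_le_iff)
  also have "\<dots> = 20 * q\<^sup>2 * w + (\<Sum>b<q\<^sup>2. real (offset (?X b) q (Suc q)) + 2 * w)"
    by simp
  also have "\<dots> \<le> 20 * q\<^sup>2 * w + (\<Sum>b<q\<^sup>2. (q * log 2 (?X b) + 6 + w) + 2 * w)"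
    using q w width_alphabet_le[of q n w q]
    by (intro add_mono sum_mono offset_end_le order_refl) (auto simp: alphabet_def)
  also have "\<dots> = 20 * q\<^sup>2 * w + (\<Sum>b<q\<^sup>2. q * log 2 (?X b)) + q\<^sup>2 * (6 + 3 * w)"
    by (simp add: sum.distrib algebra_simps)
  also have "\<dots> \<le> 20 * q\<^sup>2 * w + (log 2 (fact n) + real (2 * q\<^sup>2 * (w + 1)) + real ((q ^ 3 - n) * w)) + q\<^sup>2 * (6 + 3 * w)"
    by (intro add_mono order_refl sum_log_alphabet_le q w)
  \<comment> \<open>With \<open>w\<close> at least 1 the four contributions are at most 20, 4, 3 and
    9 times \<open>q ^ 2 * w\<close>.\<close>
  also have "\<dots> \<le> log 2 (fact n) + 40 * (real q)\<^sup>2 * w"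
  proof -
    have "real ((q ^ 3 - n) * w) \<le> real (3 * q\<^sup>2 * w)"
      using q(4) by (simp only: of_nat_le_iff) (intro mult_le_mono1; simp)
    moreover have "real (q\<^sup>2) * 1 \<le> real (q\<^sup>2) * w" using w by (intro mult_left_mono) auto
    ultimately show ?thesis by (simp add: algebra_simps)
  qed
  finally show ?thesis .
qed

text \<open>That is, \<open>n!\<close> is at most \<open>((n + 1) / 2) ^ n\<close>; the induction
  step is Bernoulli's inequality, by which \<open>(1 + 1 / (n + 1)) ^ (n + 1)\<close> is at least
  2.\<close>

lemma fact_mult_power2_le: "fact n * 2 ^ n \<le> (n + 1) ^ n" for n :: nat
proof (induction n)
  case (Suc n)
  have "fact (Suc n) * 2 ^ Suc n = 2 * (n + 1) * (fact n * 2 ^ n)" by (simp add: algebra_simps)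
  also have "\<dots> \<le> 2 * (n + 1) * (n + 1) ^ n" using Suc by (rule mult_le_mono2)
  also have "\<dots> = 2 * (n + 1) ^ Suc n" by simp
  also have "\<dots> \<le> (Suc n + 1) ^ Suc n"
  proof -
    have "- 1 \<le> 1 / real (Suc n)" by (rule order_trans[of _ 0]) auto
    then have "2 \<le> (1 + 1 / real (Suc n)) ^ Suc n"
      using Bernoulli_inequality[of "1 / real (Suc n)" "Suc n"] by (simp del: of_nat_Suc power_Suc)
    then have "2 * real (Suc n) ^ Suc n \<le> (1 + 1 / real (Suc n)) ^ Suc n * real (Suc n) ^ Suc n"
      by (rule mult_right_mono) simp
    also have "\<dots> = ((1 + 1 / real (Suc n)) * real (Suc n)) ^ Suc n"
      by (simp only: power_mult_distrib)
    also have "(1 + 1 / real (Suc n)) * real (Suc n) = real (Suc n + 1)"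
      by (simp add: field_simps)
    finally have "real (2 * (n + 1) ^ Suc n) \<le> real ((Suc n + 1) ^ Suc n)"
      by (simp del: power_Suc)
    then show ?thesis by (simp only: of_nat_le_iff)
  qed
  finally show ?case .
qed simp

text \<open>
  The gain of \<open>n\<close> bits over \<open>w * n\<close> is what makes the addresses of the data structure fit
  into words: it absorbs the lower order terms of the space bound.
\<close>

lemma log_fact_le:
  fixes n w :: nat
  assumes "n < 2 ^ w"
  shows "log 2 (fact n) \<le> real (w * n) - n"
proof -
  have "fact n * 2 ^ n \<le> ((2::nat) ^ w) ^ n"
    using assms by (intro le_trans[OF fact_mult_power2_le] power_mono) auto
  then have "real (fact n * 2 ^ n) \<le> real ((2 ^ w) ^ n)" by (simp only: of_nat_le_iff)
  then have "log 2 (real (fact n * 2 ^ n)) \<le> log 2 (real ((2 ^ w) ^ n))"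
    by (subst log_le_cancel_iff) (auto simp del: of_nat_mult)
  then show ?thesis by (simp add: log_mult log_nat_power flip: power_mult)
qed

section \<open>Choice of the block length and asymptotics\<close>

definition cube_root_up :: "nat \<Rightarrow> nat" where
  "cube_root_up n = nat \<lceil>real n powr (1 / 3)\<rceil>"

text \<open>The predecessor \<open>p\<close> of a positive rounded root has \<open>p ^ 3\<close> at
  most \<open>n\<close>, and \<open>(p + 1) ^ 3 - p ^ 3\<close> is at most
  \<open>3 * (p + 1) ^ 2\<close>.\<close>

lemma cube_root_up:
  "n \<le> cube_root_up n ^ 3" "cube_root_up n ^ 3 \<le> n + 3 * (cube_root_up n)\<^sup>2"
  "real (cube_root_up n) \<le> real n powr (1 / 3) + 1" "0 < n \<Longrightarrow> 0 < cube_root_up n"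
proof -
  let ?q = "cube_root_up n" and ?r = "real n powr (1 / 3)"
  have r3: "?r ^ 3 = n" by (cases "n = 0") (auto simp: powr_powr simp flip: powr_numeral)
  have q: "?r \<le> ?q" "?q \<le> ?r + 1"
  proof -
    have "real ?q = of_int \<lceil>?r\<rceil>" by (simp add: cube_root_up_def)
    then show "?r \<le> ?q" "?q \<le> ?r + 1" by linarith+
  qed
  show "real ?q \<le> ?r + 1" by (fact q(2))
  have "real n \<le> real (?q ^ 3)" using power_mono[OF q(1), of 3] r3 by simp
  then show n: "n \<le> ?q ^ 3" by (simp only: of_nat_le_iff)
  then show "0 < ?q" if "0 < n" using that by (cases "?q = 0") auto
  show "?q ^ 3 \<le> n + 3 * ?q\<^sup>2"
  proof (cases ?q)
    case (Suc p)
    have "real p ^ 3 \<le> ?r ^ 3" using q(2) Suc by (intro power_mono) auto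
    then have "real (p ^ 3) \<le> real n" using r3 by simp
    then have "p ^ 3 \<le> n" by (simp only: of_nat_le_iff)
    then show ?thesis unfolding Suc by (simp add: power3_eq_cube power2_eq_square algebra_simps)
  qed simp
qed

lemma space_bound_bigo:
  assumes "(\<lambda>n. real (w n)) \<in> \<Theta>(\<lambda>n. log 2 (real n))"
  shows "(\<lambda>n. 40 * (real (cube_root_up n))\<^sup>2 * real (w n)) \<in> O(\<lambda>n. real n powr (2 / 3) * log 2 (real n))"
proof -
  have "(\<lambda>n. real (cube_root_up n)) \<in> O(\<lambda>n. real n powr (1 / 3) + 1)"
    using cube_root_up(3) by (intro bigoI[of _ 1] always_eventually) (auto simp: abs_of_nonneg)
  also have "(\<lambda>n. real n powr (1 / 3) + 1) \<in> O(\<lambda>n. real n powr (1 / 3))" by real_asymp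
  finally have q: "(\<lambda>n. real (cube_root_up n)) \<in> O(\<lambda>n. real n powr (1 / 3))" .
  have "(\<lambda>n. (real (cube_root_up n))\<^sup>2 * real (w n)) \<in> O(\<lambda>n. (real n powr (1 / 3))\<^sup>2 * log 2 (real n))"
    using assms by (intro landau_o.big.mult landau_o.big_power q) (auto simp: bigtheta_def)
  also have "(\<lambda>n. (real n powr (1 / 3))\<^sup>2 * log 2 (real n)) = (\<lambda>n. real n powr (2 / 3) * log 2 (real n))"
    by (intro ext) (simp add: power2_eq_square flip: powr_add)
  finally show ?thesis by (simp add: mult.assoc)
qed

text \<open>Under this condition the redundancy is at most the \<open>n\<close> bits gained in
  \<open>log_fact_le\<close>.\<close>

definition compressible :: "nat \<Rightarrow> nat \<Rightarrow> bool" where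
  "compressible w n \<longleftrightarrow> 0 < n \<and> 40 * (cube_root_up n)\<^sup>2 * w \<le> n"

lemma eventually_compressible:
  assumes "(\<lambda>n. real (w n)) \<in> \<Theta>(\<lambda>n. log 2 (real n))"
  shows "eventually (\<lambda>n. compressible (w n) n) at_top"
proof -
  have "(\<lambda>n. real n powr (2 / 3) * log 2 (real n)) \<in> o(\<lambda>n. real n)" by real_asymp
  then have "(\<lambda>n. 40 * (real (cube_root_up n))\<^sup>2 * real (w n)) \<in> o(\<lambda>n. real n)"
    by (rule landau_o.big_small_trans[OF space_bound_bigo[OF assms]])
  then have "eventually (\<lambda>n. norm (40 * (real (cube_root_up n))\<^sup>2 * real (w n)) \<le> 1 * norm (real n)) at_top"
    by (rule landau_o.smallD) simp
  then show ?thesis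
    using eventually_gt_at_top[of 0]
  proof eventually_elim
    case (elim n)
    then have "real (40 * (cube_root_up n)\<^sup>2 * w n) \<le> real n" by simp
    then show ?case unfolding compressible_def using elim(2) by (simp only: of_nat_le_iff)
  qed
qed

subsection \<open>Encoding\<close>

text \<open>The padding by 0 covers verbatim blocks that run past \<open>n\<close>.\<close>

definition degree_seq :: "nat \<Rightarrow> (nat \<Rightarrow> nat) \<Rightarrow> nat \<Rightarrow> nat" where
  "degree_seq n e u = (if u < n then degree (interval_graph {1..n} (rep_interval e)) (Suc u) else 0)"

definition ended :: "nat \<Rightarrow> (nat \<Rightarrow> nat) \<Rightarrow> nat \<Rightarrow> nat" where
  "ended n e u = card {x \<in> {1..n}. e x \<le> u}"

lemma degree_seq_bounds:
  assumes "universal_rep n e" "u < n"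
  shows "u \<le> degree_seq n e u + ended n e u \<and> degree_seq n e u + ended n e u < n"
proof -
  have "Suc u \<le> e (Suc u) \<and> e (Suc u) \<le> n" using assms unfolding universal_rep_def by auto
  then show ?thesis using degree_eq[OF assms] assms(2) by (simp add: degree_seq_def ended_def)
qed

lemma degree_seq_less:
  assumes "universal_rep n e" "0 < n"
  shows "degree_seq n e u < n"
  using degree_seq_bounds[OF assms(1), of u] assms(2) by (cases "u < n") (auto simp: degree_seq_def)

lemma card_exceptional_degree_seq:
  assumes "universal_rep n e" "n \<le> q ^ 3" "0 < q"
  shows "card {b. b < q\<^sup>2 \<and> exceptional n q (degree_seq n e) b} \<le> 3 * q"
proof (rule card_exceptional[where C = "ended n e"])
  show "mono (ended n e)" unfolding ended_def by (intro monoI card_mono) auto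
  have "ended n e (q\<^sup>2 * q) \<le> card {1..n}" unfolding ended_def by (intro card_mono) auto
  then show "ended n e (q\<^sup>2 * q) \<le> q ^ 3" using assms(2) by simp
qed (use assms degree_seq_bounds in auto)

definition encoding :: "nat \<Rightarrow> nat \<Rightarrow> (nat \<Rightarrow> nat) \<Rightarrow> nat list" where
  "encoding w n e =
    (if compressible w n then layout w n (cube_root_up n) (degree_seq n e)
     else 0 # map (degree_seq n e) [0..<n])"

lemma compressible_encoding:
  assumes sp: "compressible w n" and rep: "universal_rep n e" and w: "n < 2 ^ w"
  defines "d \<equiv> layout w n (cube_root_up n) (degree_seq n e)"
  shows "\<forall>z\<in>set d. z < 2 ^ w"
    and "real (w * length d) \<le> log 2 (fact n) + 40 * (real (cube_root_up n))\<^sup>2 * w"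
    and "u < n \<Longrightarrow> answers_within w query d (Suc u) 100 (degree_seq n e u)"
proof -
  define q where "q = cube_root_up n"
  have n: "0 < n" "40 * q\<^sup>2 * w \<le> n" using sp by (auto simp: compressible_def q_def)
  have q: "0 < q" "n \<le> q ^ 3" "q ^ 3 \<le> n + 3 * q\<^sup>2"
    using cube_root_up[of n] n(1) by (auto simp: q_def)
  have w0: "0 < w" using w n by (cases w) auto
  have "40 * q\<^sup>2 * 1 \<le> 40 * q\<^sup>2 * w" using w0 by (intro mult_le_mono2) simp
  then have qn: "40 * q\<^sup>2 \<le> n" using n by linarith
  then have q2: "2 * q\<^sup>2 \<le> n" by simp
  have "1 \<le> q\<^sup>2" using q by simp
  then have "40 < (2::nat) ^ w" using qn w by linarith
  then have w2: "2 < w"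
    using power_increasing[of w 2 "2::nat"] by (cases "w \<le> 2") auto
  have d: "d = layout w n q (degree_seq n e)" by (simp add: d_def q_def)
  note D = degree_seq_less[OF rep n(1)]
  show space: "real (w * length d) \<le> log 2 (fact n) + 40 * (real (cube_root_up n))\<^sup>2 * w"
    using layout_space[OF q(1) q2 q(2,3) w w0 card_exceptional_degree_seq[OF rep q(2,1)]]
    unfolding d q_def .
  have "real (40 * q\<^sup>2 * w) \<le> real n" using n(2) by (simp only: of_nat_le_iff)
  \<comment> \<open>The gain makes up for the redundancy: there are at most \<open>n\<close> words,
    so all their addresses are below \<open>2 ^ w\<close>.\<close>
  then have "real (w * length d) \<le> real (w * n)"
    using space log_fact_le[OF w] by (simp add: q_def)
  then have len: "length (layout w n q (degree_seq n e)) \<le> n"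
    using w0 by (simp only: of_nat_le_iff mult_le_cancel1 d)
  show "\<forall>z\<in>set d. z < 2 ^ w"
    using layout_words[OF q(1) q2 w w0 len D] unfolding d by blast
  show "answers_within w query d (Suc u) 100 (degree_seq n e u)" if "u < n"
    using layout_answers[OF q(1) q2 q(2) w w2 len D that] unfolding d .
qed

lemma direct_encoding:
  assumes rep: "universal_rep n e" and w: "n < 2 ^ w"
  defines "d \<equiv> 0 # map (degree_seq n e) [0..<n]"
  shows "\<forall>z\<in>set d. z < 2 ^ w"
    and "u < n \<Longrightarrow> answers_within w query d (Suc u) 100 (degree_seq n e u)"
proof -
  show "\<forall>z\<in>set d. z < 2 ^ w"
    using degree_seq_less[OF rep] w by (cases "n = 0") (auto simp: d_def intro: less_trans)
  show "answers_within w query d (Suc u) 100 (degree_seq n e u)" if "u < n"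
    using query_direct[of "Suc u" d w] that by (simp add: d_def)
qed

text \<open>A word size in \<open>\<Theta>(log n)\<close> may still be too small for a label, hence
  \<open>labels_fit\<close>. The program and the time bound are chosen before
  \<open>n\<close>.\<close>

theorem theorem3:
  fixes w :: "nat \<Rightarrow> nat"
  assumes word_size: "(\<lambda>n. real (w n)) \<in> \<Theta>(\<lambda>n. log 2 (real n))"
    and labels_fit: "\<And>n. n < 2 ^ w n"
  shows "\<exists>(P :: program) (encode :: nat \<Rightarrow> (nat \<Rightarrow> nat) \<Rightarrow> nat list) (T :: nat) (g :: nat \<Rightarrow> real).
    g \<in> O(\<lambda>n. real n powr (2 / 3) * log 2 (real n)) \<and>
    (\<forall>n e. universal_rep n e \<longrightarrow>
       (\<forall>x\<in>set (encode n e). x < 2 ^ w n) \<and>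
       real (space_bits (w n) (encode n e)) \<le> log 2 (fact n) + g n \<and>
       (\<forall>v\<in>{1..n}. answers_within (w n) P (encode n e) v T
          (degree (interval_graph {1..n} (rep_interval e)) v)))"
proof -
  define f where "f n = 40 * (real (cube_root_up n))\<^sup>2 * real (w n)" for n
  \<comment> \<open>Only finitely many \<open>n\<close> are incompressible, so the crude bound there
    does not affect the asymptotics.\<close>
  define g where "g n = (if compressible (w n) n then f n else real (w n * (n + 1)))" for n
  define encode where "encode n e = encoding (w n) n e" for n e
  have "eventually (\<lambda>n. f n = g n) at_top"
    using eventually_compressible[OF word_size] by eventually_elim (simp add: g_def)
  then have g: "g \<in> O(\<lambda>n. real n powr (2 / 3) * log 2 (real n))"
    using space_bound_bigo[OF word_size] landau_o.big.in_cong[of f g] by (simp add: f_def[abs_def])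
  have enc: "(\<forall>x\<in>set (encode n e). x < 2 ^ w n) \<and>
       real (space_bits (w n) (encode n e)) \<le> log 2 (fact n) + g n \<and>
       (\<forall>v\<in>{1..n}. answers_within (w n) query (encode n e) v 100
          (degree (interval_graph {1..n} (rep_interval e)) v))" if rep: "universal_rep n e" for n e
  proof (intro conjI ballI)
    show "x < 2 ^ w n" if "x \<in> set (encode n e)" for x
      using that compressible_encoding(1)[OF _ rep labels_fit] direct_encoding(1)[OF rep labels_fit]
      unfolding encode_def encoding_def by (auto split: if_splits)
    show "real (space_bits (w n) (encode n e)) \<le> log 2 (fact n) + g n"
    proof (cases "compressible (w n) n")
      case True
      then show ?thesis
        using compressible_encoding(2)[OF True rep labels_fit]
        by (simp add: space_bits_def encode_def encoding_def g_def f_def)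
    next
      case False
      have "0 \<le> log 2 (fact n :: real)" by (simp add: fact_ge_1)
      then show ?thesis using False by (simp add: space_bits_def encode_def encoding_def g_def)
    qed
    fix v assume v: "v \<in> {1..n}"
    then obtain u where u: "v = Suc u" "u < n" by (cases v) auto
    then show "answers_within (w n) query (encode n e) v 100
          (degree (interval_graph {1..n} (rep_interval e)) v)"
      using compressible_encoding(3)[OF _ rep labels_fit, of u] direct_encoding(2)[OF rep labels_fit, of u]
      unfolding encode_def encoding_def by (auto simp: degree_seq_def)
  qed
  show ?thesis using g enc by blast
qed

end
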